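(* Let $f:\mathcal S\times\mathcal W\to\mathbb R$ and $\Delta:\mathcal S\times\mathcal W\to\mathbb R^+$. Let $\hat{\mathcal W}$ be an arbitrary set and $g:\mathcal S\times\hat{\mathcal W}\to\mathbb R$ arbitrary. Let $\delta>0$ and $\mathcal F^\delta_{S,W}:=\mathcal G^\delta_{S,W}\cap\mathcal S_{S,W}(f-\Delta)$. Then with probability at least $1-\delta$ over $(S,W)\sim P_{S,W}$, $f(S,W)\le\Delta(S,W)$, provided either of the following holds: (i) for some $\epsilon\in\mathbb R$ and every $\nu_{S,W}\in\mathcal F^\delta_{S,W}$ (with $S$-marginal $\nu_S$ and conditional $\nu_{W|S}$), $$\inf_{p_{\hat W|S}\in\mathcal Q(\nu_{S,W})}\ \inf_{\lambda>0,\,q_{\hat W|S}}\Big\{\mathfrak T_{1,P_S}(\nu_S,p_{\hat W|S},q_{\hat W|S},\lambda g)-D_{KL}(\nu_{S,W}\|P_{W|S}\nu_S)-\lambda\big(\mathbb E_{\nu_{S,W}}[\Delta(S,W)]-\epsilon\big)\Big\}\le\log\delta,$$ where $\mathcal Q(\nu_{S,W})$ is the set of conditionals $p_{\hat W|S}$ with $\mathbb E_{\nu_{S,W}p_{\hat W|S}}[\Delta(S,W)-g(S,\hat W)]\le\epsilon$; (ii) $f>0$, and for some $\alpha>1$ and every $\nu_{S,W}\in\mathcal F^\delta_{S,W}$, $$\inf_{q_{W|S},\ \lambda\ge\alpha/(\alpha-1)}\Big\{\mathfrak T_{\alpha,P_S}(\nu_S,\nu_{W|S},q_{W|S},\lambda\log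 f)-D_{KL}(\nu_{S,W}\|P_{W|S}\nu_S)-\lambda\,\mathbb E_{\nu_S}\big[\log\mathbb E_{\nu_{W|S}}[\Delta(S,W)]\big]\Big\}\le\log\delta.$$
   Context: Setup: $\mathcal Z$ data space, $\mathcal W$ hypothesis space, $S=(Z_1,\dots,Z_n)\sim P_S=\mu^{\otimes n}$ in $\mathcal S=\mathcal Z^n$; a (possibly stochastic) algorithm outputs $W$, inducing $P_{W|S}$ and $P_{S,W}=P_SP_{W|S}$. Natural logarithms. Rényi divergence of order $\alpha\ne1$: $D_\alpha(Q\|P)=\frac1{\alpha-1}\log\mathbb E_Q[(dQ/dP)^{\alpha-1}]$ if $Q\ll P$, else $\infty$; $D_{KL}(Q\|P)=\mathbb E_Q[\log dQ/dP]$ if $Q\ll P$, else $\infty$ ($D_1:=D_{KL}$). For a random variable $X$ with law $P_X$ on $\mathcal X$ and $h:\mathcal X\to\mathbb R$: $\mathcal G^\delta_X=\{\nu_X\text{ distribution on }\mathcal X: D_{KL}(\nu_X\|P_X)\le\log(1/\delta)\}$ and $\mathcal S_X(h)=\{\nu_X: h(x)>0\ \forall x\in\mathrm{supp}(\nu_X)\}$. For $\alpha\ge1$, distributions $P_S,\nu_S$ on $\mathcal S$, conditionals $p_{\hat W|S},q_{\hat W|S}$ on $\hat{\mathcal W}$, and $h:\mathcal S\times\hat{\mathcal W}\to\mathbb R$: $$\mathfrak T_{\alpha,P_S}(\nu_S,p_{\hat W|S},q_{\hat W|S},h)=\mathbb E_{\nu_S}\big[D_\alpha(p_{\hat W|S}\|q_{\hat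 W|S})\big]+\log\mathbb E_{P_Sq_{\hat W|S}}\big[e^{h(S,\hat W)}\big];$$ for $\alpha=1$ the first term is $D_{KL}(p_{\hat W|S}\nu_S\|q_{\hat W|S}\nu_S)$. In (ii), $e^{\lambda\log f}=f^\lambda$. Notation $p_{\hat W|S}\nu_S$ denotes the joint distribution of $(S,\hat W)$ with $S\sim\nu_S$, $\hat W|S\sim p_{\hat W|S}$. *)

theory Defs
  imports "HOL-Probability.Probability"
begin

definition ln_enn :: "ennreal \<Rightarrow> ereal" where
  "ln_enn x = (if x = 0 then -\<infinity> else if x = \<top> then \<infinity> else ereal (ln (enn2real x)))"

text \<open>Expectation of an extended-real valued function: positive part minus negative part
  (with the Isabelle convention that \<infinity> - \<infinity> = \<infinity>).\<close>
definition Eext :: "'a measure \<Rightarrow> ('a \<Rightarrow> ereal) \<Rightarrow> ereal" where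
  "Eext M h = enn2ereal (\<integral>\<^sup>+ x. e2ennreal (h x) \<partial>M) - enn2ereal (\<integral>\<^sup>+ x. e2ennreal (- h x) \<partial>M)"

definition KL :: "'a measure \<Rightarrow> 'a measure \<Rightarrow> ereal" where
  "KL Q P = (if sets Q = sets P \<and> absolutely_continuous P Q
     then Eext Q (\<lambda>x. ereal (ln (enn2real (RN_deriv P Q x)))) else \<infinity>)"

definition Renyi :: "real \<Rightarrow> 'a measure \<Rightarrow> 'a measure \<Rightarrow> ereal" where
  "Renyi a Q P = (if sets Q = sets P \<and> absolutely_continuous P Q
     then ln_enn (\<integral>\<^sup>+ x. ennreal (enn2real (RN_deriv P Q x) powr (a - 1)) \<partial>Q) / ereal (a - 1)
     else \<infinity>)"

definition kernels :: "'s measure \<Rightarrow> 'w measure \<Rightarrow> ('s \<Rightarrow> 'w measure) set" where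
  "kernels M N = M \<rightarrow>\<^sub>M prob_algebra N"

definition kjoint :: "'s measure \<Rightarrow> 'w measure \<Rightarrow> ('s \<Rightarrow> 'w measure) \<Rightarrow> ('s \<times> 'w) measure" where
  "kjoint \<nu> N K = \<nu> \<bind> (\<lambda>s. distr (K s) (\<nu> \<Otimes>\<^sub>M N) (Pair s))"

definition kjoint3 :: "('s \<times> 'w) measure \<Rightarrow> 'h measure \<Rightarrow> ('s \<Rightarrow> 'h measure) \<Rightarrow> (('s \<times> 'w) \<times> 'h) measure" where
  "kjoint3 \<nu> N p = \<nu> \<bind> (\<lambda>sw. distr (p (fst sw)) (\<nu> \<Otimes>\<^sub>M N) (Pair sw))"

definition Gset :: "real \<Rightarrow> 'a measure \<Rightarrow> 'a measure set" where
  "Gset \<delta> P = {\<nu>. prob_space \<nu> \<and> sets \<nu> = sets P \<and> KL \<nu> P \<le> ereal (ln (1 / \<delta>))}"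

text \<open>The set S_X(h): distributions \<nu> on which h > 0 on the support (read as \<nu>-almost surely).\<close>
definition Sset :: "'a measure \<Rightarrow> ('a \<Rightarrow> real) \<Rightarrow> 'a measure set" where
  "Sset P h = {\<nu>. prob_space \<nu> \<and> sets \<nu> = sets P \<and> (AE x in \<nu>. h x > 0)}"

definition Tfun :: "real \<Rightarrow> 's measure \<Rightarrow> 's measure \<Rightarrow> 'h measure \<Rightarrow>
    ('s \<Rightarrow> 'h measure) \<Rightarrow> ('s \<Rightarrow> 'h measure) \<Rightarrow> ('s \<times> 'h \<Rightarrow> real) \<Rightarrow> ereal" where
  "Tfun a PS \<nu>S N p q h =
     (if a = 1 then KL (kjoint \<nu>S N p) (kjoint \<nu>S N q)
      else Eext \<nu>S (\<lambda>s. Renyi a (p s) (q s)))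
     + ln_enn (\<integral>\<^sup>+ x. ennreal (exp (h x)) \<partial>(kjoint PS N q))"

end

theory Submission
  imports Defs
begin

text \<open>
  Suppose that the event \<open>f > \<Delta>\<close> has probability larger than \<open>\<delta>\<close>. Conditioning \<open>P\<^sub>S\<^sub>W\<close> on a subset
  \<open>A\<close> of it with \<open>P(A) > \<delta>\<close> yields a law \<open>\<nu>\<close> with \<open>KL(\<nu>, P\<^sub>S\<^sub>W) = - ln P(A) < ln (1/\<delta>)\<close>, so \<open>\<nu>\<close> belongs
  to the family \<open>F\<close>. By the chain rule, \<open>KL(\<nu>, P\<^sub>S\<^sub>W)\<close> is the sum of \<open>KL(\<nu>\<^sub>S, P\<^sub>S)\<close> and
  \<open>KL(\<nu>, P\<^sub>W\<^sub>|\<^sub>S \<nu>\<^sub>S)\<close>; here both summands are explicit in terms of the section probabilities \<open>b(s)\<close> of \<open>A\<close>.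
  The Donsker-Varadhan inequality then bounds the expression in braces from below by
  \<open>ln P(A) > ln \<delta>\<close>, which contradicts the hypothesis. In case (ii) a Hoelder inequality first bounds
  \<open>\<lambda> ln E[\<Delta>]\<close> by the Renyi divergence plus \<open>ln E[f\<^sup>\<lambda>]\<close> for every fixed sample.
  Truncating \<open>A\<close> makes \<open>ln \<Delta>\<close> and \<open>ln b\<close> bounded on it.
\<close>

section \<open>Divergence inequalities\<close>

lemma Eext_integrable:
  fixes h :: "'a \<Rightarrow> real"
  assumes "integrable M h"
  shows "Eext M (\<lambda>x. ereal (h x)) = ereal (integral\<^sup>L M h)"
proof -
  have "(\<integral>\<^sup>+ x. ennreal (h x) \<partial>M) \<noteq> \<infinity>" "(\<integral>\<^sup>+ x. ennreal (- h x) \<partial>M) \<noteq> \<infinity>"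
    using assms by (auto simp: real_integrable_def)
  then obtain a b where "0 \<le> a" "0 \<le> b"
    "(\<integral>\<^sup>+ x. ennreal (h x) \<partial>M) = ennreal a" "(\<integral>\<^sup>+ x. ennreal (- h x) \<partial>M) = ennreal b"
    by (metis ennreal_cases infinity_ennreal_def)
  then show ?thesis
    by (simp add: Eext_def real_lebesgue_integral_def[OF assms] enn2ereal_ennreal)
qed

text \<open>Since \<open>\<infinity> - \<infinity> = \<infinity>\<close> here, an infinite positive
  part would force \<open>Eext\<close> to be \<infinity> whatever the negative part is.\<close>

lemma Eext_less_top_imp:
  assumes "Eext M h < \<infinity>"
  shows "(\<integral>\<^sup>+ x. e2ennreal (h x) \<partial>M) < \<infinity>"
proof (rule ccontr)
  assume "\<not> ?thesis"
  then have "(\<integral>\<^sup>+ x. e2ennreal (h x) \<partial>M) = top"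
    by (metis infinity_ennreal_def less_top)
  with assms show False by (simp add: Eext_def)
qed

text \<open>Serves pointwise upper bounds such as the one behind Donsker-Varadhan: the bound
  controls the positive part, so only the negative part needs a hypothesis.\<close>

lemma integrable_if_bounded_above:
  fixes h k :: "'a \<Rightarrow> real"
  assumes h[measurable]: "h \<in> borel_measurable M"
    and neg: "(\<integral>\<^sup>+ x. ennreal (- h x) \<partial>M) < \<infinity>"
    and k: "integrable M k" and le: "AE x in M. h x \<le> k x"
  shows "integrable M h"
proof -
  have "(\<integral>\<^sup>+ x. ennreal (h x) \<partial>M) \<le> (\<integral>\<^sup>+ x. ennreal (k x) \<partial>M)"
    using le by (intro nn_integral_mono_AE) (auto simp: ennreal_leI elim!: eventually_mono)
  also have "\<dots> < \<infinity>"
    using k by (auto simp: real_integrable_def less_top)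
  finally show ?thesis
    using neg by (auto simp: real_integrable_def)
qed

section \<open>Densities and finite Kullback-Leibler divergence\<close>

text \<open>\<open>Q\<close> is sigma-finite, so the derivative is finite \<open>P\<close>-almost
  everywhere and \<open>enn2real\<close> loses nothing; the zero set of the density has no
  \<open>Q\<close>-mass.\<close>

lemma RN_deriv_real:
  assumes "prob_space P" "prob_space Q" and ac: "absolutely_continuous P Q" and sets: "sets Q = sets P"
  defines "r \<equiv> \<lambda>x. enn2real (RN_deriv P Q x)"
  shows "r \<in> borel_measurable P" "Q = density P (\<lambda>x. ennreal (r x))" "AE x in Q. 0 < r x"
proof -
  interpret P: prob_space P by fact
  interpret Q: prob_space Q by fact
  show m: "r \<in> borel_measurable P" unfolding r_def by measurable
  have "AE x in P. RN_deriv P Q x = ennreal (r x)"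
    using P.RN_deriv_finite[OF Q.sigma_finite_measure ac sets]
    by eventually_elim (simp add: r_def less_top)
  then have "density P (RN_deriv P Q) = density P (\<lambda>x. ennreal (r x))"
    using m by (intro density_cong) auto
  then show eq: "Q = density P (\<lambda>x. ennreal (r x))"
    using P.density_RN_deriv[OF ac sets] by simp
  show "AE x in Q. 0 < r x"
    by (subst eq, subst AE_density) (use m in auto)
qed

text \<open>The density cancels where it is positive. Where it vanishes the left integrand
  contributes 0, hence an inequality rather than an equality.\<close>

lemma nn_integral_divide_RN_deriv_le:
  assumes "prob_space P" "prob_space Q" and ac: "absolutely_continuous P Q" and sets: "sets Q = sets P"
    and h[measurable]: "h \<in> borel_measurable P"
  shows "(\<integral>\<^sup>+ x. ennreal (h x / enn2real (RN_deriv P Q x)) \<partial>Q) \<le> (\<integral>\<^sup>+ x. ennreal (h x) \<partial>P)"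
proof -
  let ?r = "\<lambda>x. enn2real (RN_deriv P Q x)"
  note r = RN_deriv_real[OF assms(1-4)]
  note r(1)[measurable]
  have "(\<integral>\<^sup>+ x. ennreal (h x / ?r x) \<partial>Q) = (\<integral>\<^sup>+ x. ennreal (h x / ?r x) \<partial>density P (\<lambda>x. ennreal (?r x)))"
    using r(2) by simp
  also have "\<dots> = (\<integral>\<^sup>+ x. ennreal (?r x) * ennreal (h x / ?r x) \<partial>P)"
    by (intro nn_integral_density) auto
  also have "\<dots> \<le> (\<integral>\<^sup>+ x. ennreal (h x) \<partial>P)"
    by (intro nn_integral_mono) (simp add: ennreal_mult'[symmetric])
  finally show ?thesis .
qed

text \<open>The negative part of the log-density is always \<open>Q\<close>-integrable, because - ln
  r \<le> 1/r and 1/r has \<open>Q\<close>-integral at most 1. Finiteness of the divergence controls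
  the positive part.\<close>

lemma KL_finite_integrable:
  assumes "prob_space P" "prob_space Q" and fin: "KL Q P < \<infinity>"
  shows "sets Q = sets P" "absolutely_continuous P Q"
    "integrable Q (\<lambda>x. ln (enn2real (RN_deriv P Q x)))"
    "KL Q P = ereal (\<integral>x. ln (enn2real (RN_deriv P Q x)) \<partial>Q)"
proof -
  let ?r = "\<lambda>x. enn2real (RN_deriv P Q x)"
  interpret P: prob_space P by fact
  interpret Q: prob_space Q by fact
  show sets: "sets Q = sets P" and ac: "absolutely_continuous P Q"
    using fin by (auto simp: KL_def split: if_splits)
  note r = RN_deriv_real[OF assms(1,2) ac sets]
  have m[measurable]: "?r \<in> borel_measurable Q"
    using r(1) by (simp add: measurable_cong_sets[OF sets refl])
  have KL: "KL Q P = Eext Q (\<lambda>x. ereal (ln (?r x)))"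
    using sets ac by (simp add: KL_def)
  have "(\<integral>\<^sup>+ x. ennreal (- ln (?r x)) \<partial>Q) \<le> (\<integral>\<^sup>+ x. ennreal (1 / ?r x) \<partial>Q)"
  proof (rule nn_integral_mono_AE)
    show "AE x in Q. ennreal (- ln (?r x)) \<le> ennreal (1 / ?r x)"
      using r(3)
    proof eventually_elim
      case (elim x)
      then show ?case
        using ln_le_minus_one[of "1 / ?r x"] by (intro ennreal_leI) (auto simp: ln_div)
    qed
  qed
  also have "\<dots> \<le> (\<integral>\<^sup>+ x. ennreal 1 \<partial>P)"
    by (rule nn_integral_divide_RN_deriv_le[OF assms(1,2) ac sets]) auto
  also have "\<dots> < \<infinity>"
    by (simp add: P.emeasure_space_1)
  finally have neg: "(\<integral>\<^sup>+ x. ennreal (- ln (?r x)) \<partial>Q) < \<infinity>" .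
  have pos: "(\<integral>\<^sup>+ x. ennreal (ln (?r x)) \<partial>Q) < \<infinity>"
    using Eext_less_top_imp[of Q "\<lambda>x. ereal (ln (?r x))"] fin KL by simp
  show int: "integrable Q (\<lambda>x. ln (?r x))"
    using pos neg by (auto simp: real_integrable_def)
  show "KL Q P = ereal (\<integral>x. ln (?r x) \<partial>Q)"
    using KL Eext_integrable[OF int] by simp
qed

text \<open>Evaluates a divergence from an explicit density: uniqueness of the derivative holds
  \<open>P\<close>-almost everywhere and transfers to \<open>Q\<close>.\<close>

lemma KL_density_eq:
  assumes "prob_space P" "prob_space Q" and r[measurable]: "r \<in> borel_measurable P"
    and nonneg: "\<And>x. 0 \<le> r x" and Q: "Q = density P (\<lambda>x. ennreal (r x))"
    and int: "integrable Q (\<lambda>x. ln (r x))"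
  shows "KL Q P = ereal (\<integral>x. ln (r x) \<partial>Q)"
proof -
  interpret P: prob_space P by fact
  have sets: "sets Q = sets P" using Q by simp
  have ac: "absolutely_continuous P Q"
    unfolding Q by (rule absolutely_continuousI_density) auto
  have "AE x in P. ennreal (r x) = RN_deriv P Q x"
    by (rule P.RN_deriv_unique) (use Q in auto)
  then have "AE x in Q. ennreal (r x) = RN_deriv P Q x"
    unfolding Q by (subst AE_density) auto
  then have ae: "AE x in Q. enn2real (RN_deriv P Q x) = r x"
    by eventually_elim (metis enn2real_ennreal nonneg)
  have m[measurable]: "r \<in> borel_measurable Q" "RN_deriv P Q \<in> borel_measurable Q"
    by (simp_all add: measurable_cong_sets[OF sets refl])
  have int': "integrable Q (\<lambda>x. ln (enn2real (RN_deriv P Q x)))"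
    by (rule integrable_cong_AE_imp[OF int]) (use ae in auto)
  have "(\<integral>x. ln (enn2real (RN_deriv P Q x)) \<partial>Q) = (\<integral>x. ln (r x) \<partial>Q)"
    by (rule integral_cong_AE) (use ae in auto)
  then show ?thesis
    using Eext_integrable[OF int'] sets ac by (simp add: KL_def)
qed

section \<open>Donsker-Varadhan inequality\<close>

text \<open>Apply ln y \<le> y - 1 at y = exp G / (r c), with r the density of \<open>Q\<close>, and
  integrate against \<open>Q\<close>: the remainder y - 1 has integral at most 0. The same pointwise
  bound yields integrability of \<open>G\<close> from its negative part.\<close>

lemma Donsker_Varadhan:
  fixes G :: "'a \<Rightarrow> real"
  assumes "prob_space P" "prob_space Q" and fin: "KL Q P < \<infinity>"
    and G: "G \<in> borel_measurable P"
    and c: "0 < c" "(\<integral>\<^sup>+ x. ennreal (exp (G x)) \<partial>P) \<le> ennreal c"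
    and neg: "(\<integral>\<^sup>+ x. ennreal (- G x) \<partial>Q) < \<infinity>"
  shows "integrable Q G" "ereal (integral\<^sup>L Q G) \<le> KL Q P + ereal (ln c)"
proof -
  let ?r = "\<lambda>x. enn2real (RN_deriv P Q x)"
  interpret P: prob_space P by fact
  interpret Q: prob_space Q by fact
  note KL = KL_finite_integrable[OF assms(1-3)]
  note r = RN_deriv_real[OF assms(1,2) KL(2,1)]
  have m[measurable]: "?r \<in> borel_measurable Q" "G \<in> borel_measurable Q"
    using r(1) G by (simp_all add: measurable_cong_sets[OF KL(1) refl])
  let ?e = "\<lambda>x. exp (G x) / ?r x"
  let ?k = "\<lambda>x. ln (?r x) + ln c + ?e x / c - 1"
  have le_c: "(\<integral>\<^sup>+ x. ennreal (?e x) \<partial>Q) \<le> ennreal c"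
    using nn_integral_divide_RN_deriv_le[OF assms(1,2) KL(2,1), of "\<lambda>x. exp (G x)"] G c(2) by simp
  have int_e: "integrable Q ?e"
    using le_c by (intro integrableI_nonneg) (auto simp: le_less_trans[OF _ ennreal_less_top])
  have int_e_le: "(\<integral>x. ?e x \<partial>Q) \<le> c"
    using le_c c(1) by (subst (asm) nn_integral_eq_integral[OF int_e]) auto
  have int_k: "integrable Q ?k"
    using KL(3) int_e by (auto simp del: divide_divide_eq_left)
  have ae: "AE x in Q. G x \<le> ?k x"
    using r(3)
  proof eventually_elim
    case (elim x)
    have "ln (?e x / c) \<le> ?e x / c - 1"
      using elim c(1) by (intro ln_le_minus_one) auto
    moreover have "ln (?e x / c) = G x - ln (?r x) - ln c"
      using elim c(1) by (simp add: ln_div ln_mult)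
    ultimately show ?case by simp
  qed
  show int: "integrable Q G"
    by (rule integrable_if_bounded_above[OF m(2) neg int_k ae])
  have "integral\<^sup>L Q G \<le> integral\<^sup>L Q ?k"
    by (rule integral_mono_AE[OF int int_k ae])
  also have "\<dots> = (\<integral>x. ln (?r x) \<partial>Q) + ln c + (\<integral>x. ?e x \<partial>Q) / c - 1"
    using KL(3) int_e by (simp add: Q.prob_space del: divide_divide_eq_left)
  also have "\<dots> \<le> (\<integral>x. ln (?r x) \<partial>Q) + ln c"
    using int_e_le c(1) by (simp add: field_simps)
  finally show "ereal (integral\<^sup>L Q G) \<le> KL Q P + ereal (ln c)"
    by (simp add: KL(4))
qed

section \<open>Lower bound for the Renyi divergence\<close>

text \<open>Weighted AM-GM for the three points \<open>u\<close>, \<open>v\<close> and 1. The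
  exponential lies above its tangent at the weighted mean \<open>x\<close> of the logarithms, and
  averaging the tangent values returns \<open>exp x\<close>.\<close>

lemma weighted_AM_GM_one:
  fixes u v a b :: real
  assumes "0 < u" "0 < v" "0 \<le> a" "0 \<le> b" "a + b \<le> 1"
  shows "exp (a * ln u + b * ln v) \<le> a * u + b * v + (1 - a - b)"
proof -
  define x where "x = a * ln u + b * ln v"
  have tangent: "exp x * (1 + (ln y - x)) \<le> y" if "0 < y" for y
  proof -
    have "exp x * (1 + (ln y - x)) \<le> exp x * exp (ln y - x)"
      by (intro mult_left_mono) (auto simp: exp_ge_add_one_self)
    then show ?thesis using that by (simp add: exp_diff)
  qed
  have "exp x = a * (exp x * (1 + (ln u - x))) + b * (exp x * (1 + (ln v - x)))
      + (1 - a - b) * (exp x * (1 + (ln 1 - x)))"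
    by (simp add: x_def algebra_simps)
  also have "\<dots> \<le> a * u + b * v + (1 - a - b) * 1"
    using assms by (intro add_mono mult_left_mono tangent) auto
  finally show ?thesis by (simp add: x_def)
qed

text \<open>Hoelder bounds E_Q[exp L] by the product of E_Q[exp (l L) / r] to the power 1/l and
  E_Q[r powr (\<alpha> - 1)] to the power 1/(l (\<alpha> - 1)). The first expectation is at most
  \<open>c\<close>, the second gives the divergence; take logarithms and multiply by
  \<open>l\<close>.\<close>

lemma Renyi_variational_bound:
  fixes L D :: "'a \<Rightarrow> real"
  assumes "prob_space P" "prob_space Q" and sets: "sets Q = sets P"
    and \<alpha>: "1 < \<alpha>" and lam: "\<alpha> / (\<alpha> - 1) \<le> l"
    and L: "L \<in> borel_measurable P"
    and D: "AE x in Q. D x \<le> exp (L x)"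
    and d: "0 < d" "(\<integral>\<^sup>+ x. ennreal (D x) \<partial>Q) = ennreal d"
    and c: "0 < c" "(\<integral>\<^sup>+ x. ennreal (exp (l * L x)) \<partial>P) \<le> ennreal c"
  shows "ereal (l * ln d - ln c) \<le> Renyi \<alpha> Q P"
proof (cases "absolutely_continuous P Q")
  case False
  then show ?thesis by (simp add: Renyi_def)
next
  case ac: True
  interpret P: prob_space P by fact
  interpret Q: prob_space Q by fact
  let ?r = "\<lambda>x. enn2real (RN_deriv P Q x)"
  note r = RN_deriv_real[OF assms(1,2) ac sets]
  have m[measurable]: "?r \<in> borel_measurable Q" "L \<in> borel_measurable Q"
    using r(1) L by (simp_all add: measurable_cong_sets[OF sets refl])
  define I where "I = (\<integral>\<^sup>+ x. ennreal (?r x powr (\<alpha> - 1)) \<partial>Q)"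
  have Ren: "Renyi \<alpha> Q P = ln_enn I / ereal (\<alpha> - 1)"
    using ac sets by (simp add: Renyi_def I_def)
  have lam0: "0 < l"
    by (rule less_le_trans[OF _ lam]) (use \<alpha> in simp)
  show ?thesis
  proof (cases "I = \<top>")
    case True
    then show ?thesis using \<alpha> by (simp add: Ren ln_enn_def)
  next
    case False
    then obtain i where i: "0 \<le> i" "I = ennreal i" by (metis ennreal_cases)
    have "i \<noteq> 0"
    proof
      assume "i = 0"
      then have "AE x in Q. ?r x powr (\<alpha> - 1) \<le> 0"
        using i unfolding I_def by (simp add: nn_integral_0_iff_AE ennreal_eq_0_iff)
      with r(3) have "AE x in Q. False"
        by eventually_elim (auto simp: powr_gt_zero not_le[symmetric])
      then show False by simp
    qed
    with i have i0: "0 < i" by simp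
    \<comment> \<open>Hoelder for the factors \<open>exp (l L) / r\<close>, \<open>r powr (\<alpha> - 1)\<close> and \<open>1\<close>; the last weight
      \<open>1 - a - b\<close> is nonnegative precisely because \<open>l \<ge> \<alpha> / (\<alpha> - 1)\<close>.\<close>
    define a where "a = 1 / l"
    define b where "b = 1 / (l * (\<alpha> - 1))"
    have ab: "0 \<le> a" "0 \<le> b" "a + b \<le> 1" 
      using lam lam0 \<alpha> by (auto simp: a_def b_def field_simps)
    \<comment> \<open>\<open>C\<close> is \<open>c powr a * i powr b\<close>, the Hoelder bound.
      Hoelder is obtained by applying AM-GM to the factors divided by \<open>c\<close> and
      \<open>i\<close>.\<close>
    define C where "C = exp (a * ln c + b * ln i)"
    let ?u = "\<lambda>x. exp (l * L x) / ?r x"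
    let ?v = "\<lambda>x. ?r x powr (\<alpha> - 1)"
    \<comment> \<open>These coefficients absorb \<open>C\<close> and the normalisations, so that the
      integrated bound adds up to \<open>C * (a + b + (1 - a - b)) = C\<close>.\<close>
    define A1 where "A1 = C * a / c"
    define A2 where "A2 = C * b / i"
    define A3 where "A3 = C * (1 - a - b)"
    have A: "0 \<le> A1" "0 \<le> A2" "0 \<le> A3"
      using ab c(1) i0 by (auto simp: A1_def A2_def A3_def C_def)
    have "AE x in Q. D x \<le> A1 * ?u x + A2 * ?v x + A3"
      using r(3) D
    proof eventually_elim
      case (elim x)
      have 1: "a * ln (?u x / c) + b * ln (?v x / i) = L x - (a * ln c + b * ln i)"
        using elim(1) c(1) i0 lam0 \<alpha> by (simp add: ln_div ln_mult ln_powr a_def b_def field_simps)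
      have "exp (L x) = C * exp (a * ln (?u x / c) + b * ln (?v x / i))"
        unfolding 1 C_def by (simp add: exp_diff)
      also have "\<dots> \<le> C * (a * (?u x / c) + b * (?v x / i) + (1 - a - b))"
        using elim(1) c(1) i0 ab by (intro mult_left_mono weighted_AM_GM_one) (auto simp: C_def)
      also have "\<dots> = A1 * ?u x + A2 * ?v x + A3"
        by (simp add: A1_def A2_def A3_def algebra_simps)
      finally show ?case using elim(2) by simp
    qed
    then have "ennreal d \<le> (\<integral>\<^sup>+ x. ennreal (A1 * ?u x + A2 * ?v x + A3) \<partial>Q)"
      unfolding d(2)[symmetric] by (intro nn_integral_mono_AE) (auto simp: ennreal_leI elim!: eventually_mono)
    also have "\<dots> = (\<integral>\<^sup>+ x. ennreal A1 * ennreal (?u x) + ennreal A2 * ennreal (?v x) + ennreal A3 \<partial>Q)"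
      using A by (intro nn_integral_cong) (simp add: ennreal_mult'[symmetric] ennreal_plus[symmetric] del: ennreal_plus)
    also have "\<dots> = ennreal A1 * (\<integral>\<^sup>+ x. ennreal (?u x) \<partial>Q) + ennreal A2 * I + ennreal A3"
      by (simp add: nn_integral_add nn_integral_cmult I_def Q.emeasure_space_1)
    also have "\<dots> \<le> ennreal A1 * ennreal c + ennreal A2 * I + ennreal A3"
      using nn_integral_divide_RN_deriv_le[OF assms(1,2) ac sets, of "\<lambda>x. exp (l * L x)"] L c(2)
      by (intro add_mono mult_left_mono) auto
    also have "\<dots> = ennreal (A1 * c + A2 * i + A3)"
      using A c(1) i0 unfolding i(2)
      by (simp add: ennreal_mult'[symmetric] ennreal_plus[symmetric] del: ennreal_plus)
    also have "A1 * c + A2 * i + A3 = C"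
      using c(1) i0 by (simp add: A1_def A2_def A3_def algebra_simps)
    finally have "d \<le> C" by (simp add: C_def)
    then have "ln d \<le> a * ln c + b * ln i"
      using d(1) by (simp add: C_def ln_ge_iff[symmetric] ln_le_cancel_iff[symmetric] del: ln_le_cancel_iff)
    then have "l * ln d \<le> l * (a * ln c + b * ln i)"
      using lam0 by simp
    also have "\<dots> = ln c + ln i / (\<alpha> - 1)"
      using lam0 \<alpha> by (simp add: a_def b_def field_simps)
    finally show ?thesis
      using i0 \<alpha> by (simp add: Ren i(2) ln_enn_def)
  qed
qed

text \<open>The variational bound with exponent 0, test function 1 and the smallest admissible
  multiplier.\<close>

lemma Renyi_nonneg:
  assumes "prob_space P" "prob_space Q" "sets Q = sets P" and \<alpha>: "1 < \<alpha>"
  shows "0 \<le> Renyi \<alpha> Q P"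
proof -
  interpret P: prob_space P by fact
  interpret Q: prob_space Q by fact
  have "ereal (\<alpha> / (\<alpha> - 1) * ln 1 - ln 1) \<le> Renyi \<alpha> Q P"
    by (rule Renyi_variational_bound[where L = "\<lambda>_. 0" and D = "\<lambda>_. 1"])
       (use assms in \<open>auto simp: P.emeasure_space_1 Q.emeasure_space_1\<close>)
  then show ?thesis by (simp add: zero_ereal_def)
qed

section \<open>Positive parts and almost sure equality\<close>

text \<open>\<open>ennreal\<close> truncates at 0, so cancellation between summands of opposite sign
  can only lower the left side. Used to split negative parts.\<close>

lemma ennreal_add_le: "ennreal (x + y) \<le> ennreal x + ennreal y"
proof (cases "0 \<le> x \<and> 0 \<le> y")
  case False
  then show ?thesis
    by (cases "0 \<le> x"; cases "0 \<le> y") (auto simp: ennreal_neg intro: ennreal_leI)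
qed simp

lemma Eext_cong_AE:
  assumes "AE x in M. h x = h' x"
  shows "Eext M h = Eext M h'"
proof -
  have "(\<integral>\<^sup>+ x. e2ennreal (h x) \<partial>M) = (\<integral>\<^sup>+ x. e2ennreal (h' x) \<partial>M)"
    "(\<integral>\<^sup>+ x. e2ennreal (- h x) \<partial>M) = (\<integral>\<^sup>+ x. e2ennreal (- h' x) \<partial>M)"
    using assms by (auto intro!: nn_integral_cong_AE elim!: eventually_mono)
  then show ?thesis by (simp add: Eext_def)
qed

lemma integral_le_nn_integral:
  fixes h :: "'a \<Rightarrow> real"
  assumes "integrable M h" "0 \<le> c" "(\<integral>\<^sup>+ x. ennreal (h x) \<partial>M) \<le> ennreal c"
  shows "integral\<^sup>L M h \<le> c"
proof -
  have "enn2real (\<integral>\<^sup>+ x. ennreal (h x) \<partial>M) \<le> c"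
    using enn2real_mono[OF assms(3)] assms(2) by simp
  then show ?thesis
    using real_lebesgue_integral_def[OF assms(1)] enn2real_nonneg[of "\<integral>\<^sup>+ x. ennreal (- h x) \<partial>M"] by linarith
qed

text \<open>Keeps \<open>ln_enn\<close> of an exponential moment away from -\<infinity>.\<close>

lemma (in prob_space) nn_integral_exp_pos:
  fixes h :: "'a \<Rightarrow> real"
  assumes [measurable]: "h \<in> borel_measurable M"
  shows "0 < (\<integral>\<^sup>+ x. ennreal (exp (h x)) \<partial>M)"
proof (rule ccontr)
  assume "\<not> ?thesis"
  then have "AE x in M. ennreal (exp (h x)) = 0"
    by (simp add: nn_integral_0_iff_AE)
  then have "AE x in M. False" by eventually_elim (simp add: ennreal_eq_0_iff not_le)
  then show False by simp
qed

section \<open>Joint laws of kernels\<close>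

lemma kernels_cong_sets: "sets M = sets M' \<Longrightarrow> kernels M N = kernels M' N"
  unfolding kernels_def by (rule measurable_cong_sets) simp_all

lemma kernels_prob_space:
  assumes "K \<in> kernels M N" "s \<in> space M"
  shows "prob_space (K s)" "sets (K s) = sets N"
  using measurable_space[OF assms(1)[unfolded kernels_def] assms(2)] by (auto simp: space_prob_algebra)

lemma kernel_section_measurable:
  assumes K: "K \<in> kernels M N" and s: "s \<in> space M" and h: "h \<in> M \<Otimes>\<^sub>M N \<rightarrow>\<^sub>M L"
  shows "(\<lambda>w. h (s, w)) \<in> K s \<rightarrow>\<^sub>M L"
proof -
  have "(\<lambda>w. h (s, w)) \<in> N \<rightarrow>\<^sub>M L"
    by (rule measurable_compose[OF measurable_Pair1'[OF s] h])
  then show ?thesis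
    by (simp add: measurable_cong_sets[OF kernels_prob_space(2)[OF K s] refl])
qed

lemma kernels_Pair_subprob:
  assumes "K \<in> kernels M N" "sets M' = sets M"
  shows "(\<lambda>s. distr (K s) (M' \<Otimes>\<^sub>M N) (Pair s)) \<in> M \<rightarrow>\<^sub>M subprob_algebra (M' \<Otimes>\<^sub>M N)"
proof (rule measurable_distr2)
  have [measurable_cong]: "sets M' = sets M" by fact
  show "case_prod Pair \<in> M \<Otimes>\<^sub>M N \<rightarrow>\<^sub>M M' \<Otimes>\<^sub>M N"
    by measurable
  show "K \<in> M \<rightarrow>\<^sub>M subprob_algebra N"
    using assms(1) unfolding kernels_def by (rule measurable_prob_algebraD)
qed

lemma sets_kjoint:
  assumes "space \<nu> \<noteq> {}"
  shows "sets (kjoint \<nu> N K) = sets (\<nu> \<Otimes>\<^sub>M N)"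
  unfolding kjoint_def by (rule sets_bind) (use assms in auto)

section \<open>Integration over kernels\<close>

lemma kernel_nn_integral_measurable:
  assumes K: "K \<in> kernels M N" and h: "h \<in> borel_measurable (M \<Otimes>\<^sub>M N)"
  shows "(\<lambda>s. \<integral>\<^sup>+ w. h (s, w) \<partial>K s) \<in> borel_measurable M"
  by (rule nn_integral_measurable_subprob_algebra2[where N = N])
     (use h K in \<open>auto simp: kernels_def measurable_prob_algebraD\<close>)

lemma nn_integral_indicator_section:
  assumes K: "K \<in> kernels M N" and s: "s \<in> space M" and B: "B \<in> sets (M \<Otimes>\<^sub>M N)"
  shows "(\<integral>\<^sup>+ w. indicator B (s, w) \<partial>K s) = ennreal (measure (K s) (Pair s -` B))"
proof -
  interpret Ks: prob_space "K s" by (rule kernels_prob_space(1)[OF K s])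
  have "Pair s -` B \<in> sets (K s)"
    unfolding kernels_prob_space(2)[OF K s] by (rule sets_Pair1[OF B])
  then have "(\<integral>\<^sup>+ w. indicator (Pair s -` B) w \<partial>K s) = ennreal (measure (K s) (Pair s -` B))"
    by (simp add: Ks.emeasure_eq_measure)
  then show ?thesis by (simp add: indicator_def)
qed

lemma measure_section_measurable:
  assumes K: "K \<in> kernels M N" and B[measurable]: "B \<in> sets (M \<Otimes>\<^sub>M N)"
  shows "(\<lambda>s. measure (K s) (Pair s -` B)) \<in> borel_measurable M"
proof -
  have "(\<lambda>s. enn2real (\<integral>\<^sup>+ w. indicator B (s, w) \<partial>K s)) \<in> borel_measurable M"
    by (intro borel_measurable_enn2real kernel_nn_integral_measurable[OF K]) measurable
  then show ?thesis
    by (rule measurable_cong[THEN iffD1, rotated]) (simp add: nn_integral_indicator_section[OF K _ B])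
qed

text \<open>Fubini for a kernel. Identities between joint laws are reduced to this formula and
  compared section by section.\<close>

lemma nn_integral_kjoint:
  assumes K: "K \<in> kernels \<nu> N" and h: "h \<in> borel_measurable (\<nu> \<Otimes>\<^sub>M N)"
  shows "(\<integral>\<^sup>+ x. h x \<partial>kjoint \<nu> N K) = (\<integral>\<^sup>+ s. \<integral>\<^sup>+ w. h (s, w) \<partial>K s \<partial>\<nu>)"
proof -
  have "(\<integral>\<^sup>+ x. h x \<partial>kjoint \<nu> N K) = (\<integral>\<^sup>+ s. \<integral>\<^sup>+ x. h x \<partial>distr (K s) (\<nu> \<Otimes>\<^sub>M N) (Pair s) \<partial>\<nu>)"
    unfolding kjoint_def by (rule nn_integral_bind[OF h kernels_Pair_subprob[OF K refl]])
  also have "\<dots> = (\<integral>\<^sup>+ s. \<integral>\<^sup>+ w. h (s, w) \<partial>K s \<partial>\<nu>)"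
  proof (rule nn_integral_cong)
    fix s assume s: "s \<in> space \<nu>"
    have "Pair s \<in> N \<rightarrow>\<^sub>M \<nu> \<Otimes>\<^sub>M N" using s by simp
    then have "Pair s \<in> K s \<rightarrow>\<^sub>M \<nu> \<Otimes>\<^sub>M N"
      by (simp add: measurable_cong_sets[OF kernels_prob_space(2)[OF K s] refl])
    then show "(\<integral>\<^sup>+ x. h x \<partial>distr (K s) (\<nu> \<Otimes>\<^sub>M N) (Pair s)) = (\<integral>\<^sup>+ w. h (s, w) \<partial>K s)"
      by (intro nn_integral_distr) (use h in simp_all)
  qed
  finally show ?thesis .
qed

lemma prob_space_kjoint:
  assumes "prob_space \<nu>" and K: "K \<in> kernels \<nu> N"
  shows "prob_space (kjoint \<nu> N K)"
proof
  interpret prob_space \<nu> by fact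
  have "emeasure (kjoint \<nu> N K) (space (kjoint \<nu> N K)) = (\<integral>\<^sup>+ x. 1 \<partial>kjoint \<nu> N K)"
    by simp
  also have "\<dots> = (\<integral>\<^sup>+ s. \<integral>\<^sup>+ w. 1 \<partial>K s \<partial>\<nu>)"
    by (rule nn_integral_kjoint[OF K]) simp
  also have "\<dots> = (\<integral>\<^sup>+ s. 1 \<partial>\<nu>)"
    by (intro nn_integral_cong) (simp add: prob_space.emeasure_space_1 kernels_prob_space(1)[OF K])
  also have "\<dots> = 1" by (simp add: emeasure_space_1)
  finally show "emeasure (kjoint \<nu> N K) (space (kjoint \<nu> N K)) = 1" .
qed

lemma measure_eqI_nn_integral:
  assumes "sets M = sets N"
    and "\<And>h :: 'a \<Rightarrow> ennreal. h \<in> borel_measurable N \<Longrightarrow> (\<integral>\<^sup>+ x. h x \<partial>M) = (\<integral>\<^sup>+ x. h x \<partial>N)"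
  shows "M = N"
proof (rule measure_eqI[OF assms(1)])
  fix A assume A: "A \<in> sets M"
  have "(\<integral>\<^sup>+ x. indicator A x \<partial>M) = (\<integral>\<^sup>+ x. indicator A x \<partial>N)"
    using A assms(1) by (intro assms(2)) auto
  then show "emeasure M A = emeasure N A" using A assms(1) by simp
qed

section \<open>Marginals of joint laws and truncation of events\<close>

lemma kjoint3_eq_kjoint: "kjoint3 \<nu> N p = kjoint \<nu> N (\<lambda>sw. p (fst sw))"
  by (simp add: kjoint3_def kjoint_def)

text \<open>The kernel \<open>p\<close> reads only the sample, so integrating out the middle
  coordinate leaves the sample marginal joined with \<open>p\<close>.\<close>

lemma distr_kjoint3:
  assumes "prob_space \<nu>" and sets: "sets \<nu> = sets (M \<Otimes>\<^sub>M N)" and p: "p \<in> kernels M H"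
  shows "(\<lambda>sw. p (fst sw)) \<in> kernels \<nu> H"
    "distr (kjoint3 \<nu> H p) (M \<Otimes>\<^sub>M H) (\<lambda>x. (fst (fst x), snd x)) = kjoint (distr \<nu> M fst) H p"
proof -
  interpret prob_space \<nu> by fact
  have [measurable_cong]: "sets \<nu> = sets (M \<Otimes>\<^sub>M N)" by fact
  have [measurable]: "p \<in> M \<rightarrow>\<^sub>M prob_algebra H" using p by (simp add: kernels_def)
  show k: "(\<lambda>sw. p (fst sw)) \<in> kernels \<nu> H"
    unfolding kernels_def by measurable
  have s3[measurable_cong]: "sets (kjoint3 \<nu> H p) = sets ((M \<Otimes>\<^sub>M N) \<Otimes>\<^sub>M H)"
    unfolding kjoint3_eq_kjoint by (subst sets_kjoint) (auto simp: not_empty intro!: sets_pair_measure_cong sets)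
  have fst_m: "fst \<in> \<nu> \<rightarrow>\<^sub>M M" by measurable
  have ne: "space M \<noteq> {}" using not_empty measurable_space[OF fst_m] by blast
  have p': "p \<in> kernels (distr \<nu> M fst) H"
    using p kernels_cong_sets[of "distr \<nu> M fst" M H] by simp
  show "distr (kjoint3 \<nu> H p) (M \<Otimes>\<^sub>M H) (\<lambda>x. (fst (fst x), snd x)) = kjoint (distr \<nu> M fst) H p"
  proof (rule measure_eqI_nn_integral)
    show se: "sets (distr (kjoint3 \<nu> H p) (M \<Otimes>\<^sub>M H) (\<lambda>x. (fst (fst x), snd x)))
        = sets (kjoint (distr \<nu> M fst) H p)"
      using ne by (subst sets_kjoint) (auto intro!: sets_pair_measure_cong)
    fix h :: "_ \<Rightarrow> ennreal"
    assume "h \<in> borel_measurable (kjoint (distr \<nu> M fst) H p)"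
    then have h[measurable]: "h \<in> borel_measurable (M \<Otimes>\<^sub>M H)"
      by (simp add: measurable_cong_sets[OF se[symmetric] refl])
    have h': "h \<in> borel_measurable (distr \<nu> M fst \<Otimes>\<^sub>M H)"
      using h by (simp add: measurable_cong_sets[OF sets_pair_measure_cong[OF sets_distr refl] refl])
    have "(\<integral>\<^sup>+ x. h x \<partial>distr (kjoint3 \<nu> H p) (M \<Otimes>\<^sub>M H) (\<lambda>x. (fst (fst x), snd x)))
        = (\<integral>\<^sup>+ x. h (fst (fst x), snd x) \<partial>kjoint3 \<nu> H p)"
      by (rule nn_integral_distr) measurable
    also have "\<dots> = (\<integral>\<^sup>+ sw. \<integral>\<^sup>+ y. h (fst sw, y) \<partial>p (fst sw) \<partial>\<nu>)"
      unfolding kjoint3_eq_kjoint by (subst nn_integral_kjoint[OF k]) simp_all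
    also have "\<dots> = (\<integral>\<^sup>+ s. \<integral>\<^sup>+ y. h (s, y) \<partial>p s \<partial>distr \<nu> M fst)"
      by (rule nn_integral_distr[OF fst_m, symmetric]) (use kernel_nn_integral_measurable[OF p h] in simp)
    also have "\<dots> = (\<integral>\<^sup>+ x. h x \<partial>kjoint (distr \<nu> M fst) H p)"
      by (rule nn_integral_kjoint[OF p' h', symmetric])
    finally show "(\<integral>\<^sup>+ x. h x \<partial>distr (kjoint3 \<nu> H p) (M \<Otimes>\<^sub>M H) (\<lambda>x. (fst (fst x), snd x)))
        = (\<integral>\<^sup>+ x. h x \<partial>kjoint (distr \<nu> M fst) H p)" .
  qed
qed

text \<open>Continuity from below: the parts with \<open>\<bar>h x\<bar> \<le> real n\<close>
  increase to \<open>B\<close> because \<open>h\<close> is real-valued.\<close>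

lemma (in prob_space) prob_gt_bounded_part:
  fixes h :: "'a \<Rightarrow> real"
  assumes h[measurable]: "h \<in> borel_measurable M" and B[measurable]: "B \<in> events" and "\<delta> < prob B"
  obtains c where "\<delta> < prob {x \<in> B. \<bar>h x\<bar> \<le> c}" "{x \<in> B. \<bar>h x\<bar> \<le> c} \<in> events"
proof -
  define A where "A n = {x \<in> B. \<bar>h x\<bar> \<le> real n}" for n
  have A: "A n \<in> events" for n
  proof -
    have "A n = B \<inter> {x \<in> space M. \<bar>h x\<bar> \<le> real n}"
      using sets.sets_into_space[OF B] by (auto simp: A_def)
    then show ?thesis by simp
  qed
  have "(\<lambda>n. prob (A n)) \<longlonglongrightarrow> prob (\<Union>n. A n)"
    by (rule finite_Lim_measure_incseq) (use A in \<open>auto simp: A_def incseq_def\<close>)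
  also have "(\<Union>n. A n) = B"
    using real_arch_simple by (fastforce simp: A_def)
  finally have "eventually (\<lambda>n. \<delta> < prob (A n)) sequentially"
    using assms(3) by (rule order_tendstoD)
  then obtain n where "\<delta> < prob (A n)" by (auto simp: eventually_sequentially)
  then show ?thesis using that[of "real n"] A[of n] by (simp add: A_def)
qed

lemma distr_kjoint_fst:
  assumes "prob_space \<nu>" and K: "K \<in> kernels \<nu> N"
  shows "distr (kjoint \<nu> N K) \<nu> fst = \<nu>"
proof (rule measure_eqI_nn_integral)
  interpret prob_space \<nu> by fact
  have [measurable_cong]: "sets (kjoint \<nu> N K) = sets (\<nu> \<Otimes>\<^sub>M N)"
    by (rule sets_kjoint) (rule not_empty)
  fix h :: "_ \<Rightarrow> ennreal" assume [measurable]: "h \<in> borel_measurable \<nu>"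
  have "(\<integral>\<^sup>+ s. h s \<partial>distr (kjoint \<nu> N K) \<nu> fst) = (\<integral>\<^sup>+ x. h (fst x) \<partial>kjoint \<nu> N K)"
    by (rule nn_integral_distr) measurable
  also have "\<dots> = (\<integral>\<^sup>+ s. \<integral>\<^sup>+ w. h s \<partial>K s \<partial>\<nu>)"
    by (subst nn_integral_kjoint[OF K]) simp_all
  also have "\<dots> = (\<integral>\<^sup>+ s. h s \<partial>\<nu>)"
    by (intro nn_integral_cong) (simp add: prob_space.emeasure_space_1 kernels_prob_space(1)[OF K])
  finally show "(\<integral>\<^sup>+ s. h s \<partial>distr (kjoint \<nu> N K) \<nu> fst) = (\<integral>\<^sup>+ s. h s \<partial>\<nu>)" .
qed simp

text \<open>First remove the points whose section in \<open>B\<close> is null, then truncate the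
  logarithm of the section mass. Both conditions depend on the sample only, so every surviving
  section is a full section of \<open>B\<close> and keeps its mass.\<close>

lemma exists_uniform_sections_subset:
  assumes "prob_space M" and K: "K \<in> kernels M N" and B: "B \<in> sets (M \<Otimes>\<^sub>M N)"
    and less: "\<delta> < measure (kjoint M N K) B"
  obtains A \<eta> where "A \<in> sets (M \<Otimes>\<^sub>M N)" "A \<subseteq> B" "\<delta> < measure (kjoint M N K) A" "0 < \<eta>"
    "\<forall>(s, w)\<in>A. \<eta> \<le> measure (K s) (Pair s -` A)"
proof -
  interpret M: prob_space M by fact
  interpret P: prob_space "kjoint M N K" by (rule prob_space_kjoint[OF assms(1) K])
  have sets_P[measurable_cong]: "sets (kjoint M N K) = sets (M \<Otimes>\<^sub>M N)"
    by (rule sets_kjoint) (rule M.not_empty)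
  note B[measurable]
  define b where "b s = measure (K s) (Pair s -` B)" for s
  have nn_b: "(\<integral>\<^sup>+ w. indicator B (s, w) \<partial>K s) = ennreal (b s)" if "s \<in> space M" for s
    unfolding b_def by (rule nn_integral_indicator_section[OF K that B])
  have [measurable]: "b \<in> borel_measurable M"
    unfolding b_def by (rule measure_section_measurable[OF K B])
  \<comment> \<open>\<open>ln\<close> has an ordinary real value at 0, so truncating
    \<open>ln (b s)\<close> would not exclude samples with \<open>b s = 0\<close>. They are removed
    beforehand, and Fubini shows that this costs no probability.\<close>
  define Z where "Z = {x \<in> space (M \<Otimes>\<^sub>M N). x \<in> B \<and> b (fst x) = 0}"
  have Z[measurable]: "Z \<in> sets (M \<Otimes>\<^sub>M N)" unfolding Z_def by measurable
  have "emeasure (kjoint M N K) Z = (\<integral>\<^sup>+ x. indicator Z x \<partial>kjoint M N K)"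
    using Z by (simp add: sets_P)
  also have "\<dots> = (\<integral>\<^sup>+ s. \<integral>\<^sup>+ w. indicator Z (s, w) \<partial>K s \<partial>M)"
    by (rule nn_integral_kjoint[OF K]) simp
  also have "\<dots> = (\<integral>\<^sup>+ s. 0 \<partial>M)"
  proof (rule nn_integral_cong)
    fix s assume s: "s \<in> space M"
    show "(\<integral>\<^sup>+ w. indicator Z (s, w) \<partial>K s) = 0"
    proof (cases "b s = 0")
      case True
      have "(\<integral>\<^sup>+ w. indicator Z (s, w) \<partial>K s) \<le> (\<integral>\<^sup>+ w. indicator B (s, w) \<partial>K s)"
        by (intro nn_integral_mono) (auto simp: Z_def indicator_def)
      then show ?thesis using nn_b[OF s] True by simp
    next
      case False
      then have "indicator Z (s, w) = (0 :: ennreal)" for w by (simp add: Z_def)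
      then show ?thesis by simp
    qed
  qed
  finally have "measure (kjoint M N K) Z = 0" by (simp add: measure_def)
  then have "\<delta> < measure (kjoint M N K) (B - Z)"
    using less P.finite_measure_Diff'[of B Z] P.finite_measure_mono[of "B \<inter> Z" Z] B Z
    by (simp add: sets_P)
  then obtain c where c: "\<delta> < measure (kjoint M N K) {x \<in> B - Z. \<bar>ln (b (fst x))\<bar> \<le> c}"
      "{x \<in> B - Z. \<bar>ln (b (fst x))\<bar> \<le> c} \<in> sets (kjoint M N K)"
    by (rule P.prob_gt_bounded_part[rotated 2, where h = "\<lambda>x. ln (b (fst x))"]) measurable
  define A where "A = {x \<in> B - Z. \<bar>ln (b (fst x))\<bar> \<le> c}"
  have "exp (- c) \<le> measure (K s) (Pair s -` A)" if sw: "(s, w) \<in> A" for s w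
  proof -
    have "(s, w) \<in> space (M \<Otimes>\<^sub>M N)" using sw sets.sets_into_space[OF B] by (auto simp: A_def)
    with sw have s: "s \<in> space M" "b s \<noteq> 0" "- c \<le> ln (b s)" by (auto simp: A_def Z_def space_pair_measure)
    then have "0 < b s" by (simp add: b_def order.not_eq_order_implies_strict)
    then have "exp (- c) \<le> b s"
      using s(3) by (simp add: ln_ge_iff)
    also have "Pair s -` B = Pair s -` A"
      using sw s(2) by (auto simp: A_def Z_def)
    then have "b s = measure (K s) (Pair s -` A)" by (simp add: b_def)
    finally show "exp (- c) \<le> measure (K s) (Pair s -` A)" .
  qed
  then show ?thesis
    using c by (intro that[of A "exp (- c)"]) (auto simp: A_def sets_P)
qed

section \<open>Conditioning a joint law on an event\<close>

text \<open>The uniform lower bound \<open>\<eta>\<close> on the nonempty sections of the event keeps all logarithmic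
  densities bounded, so that no indeterminate extended-real expression arises.\<close>

locale conditioned_kernel = prob_space M for M :: "'s measure" +
  fixes N :: "'w measure" and K :: "'s \<Rightarrow> 'w measure" and A :: "('s \<times> 'w) set" and \<eta> :: real
  assumes K: "K \<in> kernels M N"
    and A[measurable]: "A \<in> sets (M \<Otimes>\<^sub>M N)"
    and pos: "0 < measure (kjoint M N K) A"
    and eta: "0 < \<eta>" "\<And>s w. (s, w) \<in> A \<Longrightarrow> \<eta> \<le> measure (K s) (Pair s -` A)"
begin

section \<open>The conditioned law and its sample marginal\<close>

definition "P = kjoint M N K"
definition "a = measure P A"
definition "b s = measure (K s) (Pair s -` A)"
definition "\<nu> = density P (\<lambda>x. ennreal (indicator A x / a))"
definition "\<nu>S = distr \<nu> M fst"
text \<open>A version of the conditional law of the hypothesis given the sample under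
  \<open>\<nu>\<close>. The fallback \<open>K s\<close> on null sections, which
  \<open>\<nu>S\<close> does not charge, makes it a probability measure for every sample.\<close>

definition "\<kappa> s = (if 0 < b s then density (K s) (\<lambda>w. ennreal (indicator A (s, w) / b s)) else K s)"

lemma a_pos: "0 < a"
  using pos by (simp add: a_def P_def)

lemma sets_P[measurable_cong]: "sets P = sets (M \<Otimes>\<^sub>M N)"
  unfolding P_def by (rule sets_kjoint) (rule not_empty)

lemma prob_space_P: "prob_space P"
  unfolding P_def by (rule prob_space_kjoint[OF prob_space_axioms K])

lemma sets_nu[measurable_cong]: "sets \<nu> = sets (M \<Otimes>\<^sub>M N)"
  by (simp add: \<nu>_def sets_P)

lemma sets_nuS[measurable_cong, simp]: "sets \<nu>S = sets M"
  by (simp add: \<nu>S_def)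

lemma space_nuS[simp]: "space \<nu>S = space M"
  by (simp add: \<nu>S_def)

lemma sets_K: "s \<in> space M \<Longrightarrow> sets (K s) = sets N"
  by (rule kernels_prob_space(2)[OF K])

lemma b_bounds: "0 \<le> b s" "s \<in> space M \<Longrightarrow> b s \<le> 1"
  using prob_space.prob_le_1[OF kernels_prob_space(1)[OF K]] by (simp_all add: b_def)

lemma A_imp: "(s, w) \<in> A \<Longrightarrow> \<eta> \<le> b s"
  using eta(2) by (simp add: b_def)

text \<open>A section of positive mass is nonempty, so the uniform bound applies: \<open>b\<close>
  never lies strictly between 0 and \<open>\<eta>\<close>.\<close>

lemma b_pos_imp: "0 < b s \<Longrightarrow> \<eta> \<le> b s"
proof (cases "Pair s -` A = {}")
  case False
  then show ?thesis using A_imp by auto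
qed (simp add: b_def)

lemma indicator_section_measurable:
  "s \<in> space M \<Longrightarrow> (\<lambda>w. indicator A (s, w) :: real) \<in> borel_measurable (K s)"
  by (rule kernel_section_measurable[OF K]) auto

lemma nn_integral_K_A:
  "s \<in> space M \<Longrightarrow> (\<integral>\<^sup>+ w. ennreal (indicator A (s, w)) \<partial>K s) = ennreal (b s)"
  using nn_integral_indicator_section[OF K _ A] by (simp add: b_def ennreal_indicator)

lemma b_measurable[measurable]: "b \<in> borel_measurable M"
  unfolding b_def by (rule measure_section_measurable[OF K A])

lemma nn_integral_nu:
  assumes [measurable]: "h \<in> borel_measurable (M \<Otimes>\<^sub>M N)"
  shows "(\<integral>\<^sup>+ x. h x \<partial>\<nu>) = (\<integral>\<^sup>+ s. \<integral>\<^sup>+ w. ennreal (indicator A (s, w) / a) * h (s, w) \<partial>K s \<partial>M)"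
proof -
  have "(\<integral>\<^sup>+ x. h x \<partial>\<nu>) = (\<integral>\<^sup>+ x. ennreal (indicator A x / a) * h x \<partial>P)"
    unfolding \<nu>_def by (rule nn_integral_density) measurable
  also have "\<dots> = (\<integral>\<^sup>+ s. \<integral>\<^sup>+ w. ennreal (indicator A (s, w) / a) * h (s, w) \<partial>K s \<partial>M)"
    unfolding P_def by (rule nn_integral_kjoint[OF K]) measurable
  finally show ?thesis .
qed

text \<open>Fubini: for a fixed sample the integrand depends on the hypothesis only through the
  indicator, which integrates to \<open>b s\<close>.\<close>

lemma nuS_eq: "\<nu>S = density M (\<lambda>s. ennreal (b s / a))"
proof (rule measure_eqI_nn_integral)
  fix h :: "'s \<Rightarrow> ennreal" assume "h \<in> borel_measurable (density M (\<lambda>s. ennreal (b s / a)))"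
  then have h[measurable]: "h \<in> borel_measurable M" by simp
  have "(\<integral>\<^sup>+ s. h s \<partial>\<nu>S) = (\<integral>\<^sup>+ x. h (fst x) \<partial>\<nu>)"
    unfolding \<nu>S_def by (rule nn_integral_distr) measurable
  also have "\<dots> = (\<integral>\<^sup>+ s. \<integral>\<^sup>+ w. ennreal (indicator A (s, w) / a) * h s \<partial>K s \<partial>M)"
    by (subst nn_integral_nu) simp_all
  also have "\<dots> = (\<integral>\<^sup>+ s. ennreal (b s / a) * h s \<partial>M)"
  proof (rule nn_integral_cong)
    fix s assume s: "s \<in> space M"
    note [measurable] = indicator_section_measurable[OF s]
    have "(\<integral>\<^sup>+ w. ennreal (indicator A (s, w) / a) * h s \<partial>K s)
        = (\<integral>\<^sup>+ w. ennreal (1 / a) * ennreal (indicator A (s, w)) * h s \<partial>K s)"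
      by (intro nn_integral_cong) (simp add: indicator_def)
    also have "\<dots> = ennreal (1 / a) * ennreal (b s) * h s"
      by (simp add: nn_integral_multc nn_integral_cmult nn_integral_K_A s)
    also have "\<dots> = ennreal (b s / a) * h s"
      using a_pos b_bounds(1) by (simp add: ennreal_mult'[symmetric])
    finally show "(\<integral>\<^sup>+ w. ennreal (indicator A (s, w) / a) * h s \<partial>K s) = ennreal (b s / a) * h s" .
  qed
  also have "\<dots> = (\<integral>\<^sup>+ s. h s \<partial>density M (\<lambda>s. ennreal (b s / a)))"
    by (rule nn_integral_density[symmetric]) measurable
  finally show "(\<integral>\<^sup>+ s. h s \<partial>\<nu>S) = (\<integral>\<^sup>+ s. h s \<partial>density M (\<lambda>s. ennreal (b s / a)))" .
qed simp

lemma nn_integral_nuS: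
  assumes [measurable]: "h \<in> borel_measurable M"
  shows "(\<integral>\<^sup>+ s. h s \<partial>\<nu>S) = (\<integral>\<^sup>+ s. ennreal (b s / a) * h s \<partial>M)"
  unfolding nuS_eq by (rule nn_integral_density) measurable

lemma prob_space_nu: "prob_space \<nu>"
proof
  interpret P: prob_space P by (rule prob_space_P)
  have "emeasure \<nu> (space \<nu>) = (\<integral>\<^sup>+ x. ennreal (indicator A x / a) \<partial>P)"
    unfolding \<nu>_def by (subst emeasure_density) (auto intro!: nn_integral_cong)
  also have "\<dots> = (\<integral>\<^sup>+ x. ennreal (1 / a) * indicator A x \<partial>P)"
    by (intro nn_integral_cong) (auto simp: indicator_def)
  also have "\<dots> = ennreal (1 / a) * ennreal a"
    by (simp add: nn_integral_cmult_indicator sets_P P.emeasure_eq_measure a_def)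
  also have "\<dots> = 1"
    using a_pos by (simp add: ennreal_mult'[symmetric])
  finally show "emeasure \<nu> (space \<nu>) = 1" .
qed

lemma prob_space_nuS: "prob_space \<nu>S"
  unfolding \<nu>S_def by (rule prob_space.prob_space_distr[OF prob_space_nu]) measurable

lemma AE_nu: "AE x in \<nu>. x \<in> A"
  unfolding \<nu>_def by (subst AE_density) (auto simp: indicator_def)

text \<open>The density \<open>b s / a\<close> vanishes off the samples with \<open>b s > 0\<close>,
  and there \<open>b_pos_imp\<close> applies.\<close>

lemma AE_nuS: "AE s in \<nu>S. \<eta> \<le> b s"
  unfolding nuS_eq using a_pos b_pos_imp b_bounds(1)
  by (subst AE_density) (auto simp: zero_less_divide_iff)

lemma AE_nuS_imp: "AE s in M. Q s \<Longrightarrow> AE s in \<nu>S. Q s"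
  unfolding nuS_eq by (subst AE_density) auto

section \<open>Divergences of the conditioned law in closed form\<close>

text \<open>On \<open>A\<close>, which carries \<open>\<nu>\<close>, the log-density is the constant
  \<open>ln (1 / a)\<close>.\<close>

lemma KL_nu_P: "KL \<nu> P = ereal (ln (1 / a))"
proof -
  interpret nu: prob_space \<nu> by (rule prob_space_nu)
  have ae: "AE x in \<nu>. ln (1 / a) = ln (indicator A x / a)"
    using AE_nu by eventually_elim simp
  have int: "integrable \<nu> (\<lambda>x. ln (indicator A x / a))"
    by (rule integrable_cong_AE_imp[OF nu.integrable_const[of "ln (1 / a)"]])
       (use ae in \<open>auto elim!: eventually_mono\<close>)
  have "KL \<nu> P = ereal (\<integral>x. ln (indicator A x / a) \<partial>\<nu>)"
    by (rule KL_density_eq[OF prob_space_P prob_space_nu]) (use a_pos int in \<open>auto simp: \<nu>_def\<close>)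
  also have "(\<integral>x. ln (indicator A x / a) \<partial>\<nu>) = (\<integral>x. ln (1 / a) \<partial>\<nu>)"
    by (rule integral_cong_AE) (use ae in \<open>auto elim!: eventually_mono\<close>)
  also have "\<dots> = ln (1 / a)" by (simp add: nu.prob_space)
  finally show ?thesis .
qed

lemma sets_kjoint_nuS: "sets (kjoint \<nu>S H q) = sets (M \<Otimes>\<^sub>M H)"
  using not_empty by (subst sets_kjoint) (auto intro!: sets_pair_measure_cong)

lemma K_nuS: "K \<in> kernels \<nu>S N"
  using K kernels_cong_sets[of \<nu>S M N] by simp

text \<open>Almost surely \<open>ln (b s)\<close> lies between \<open>ln \<eta>\<close> and
  0.\<close>

lemma integrable_ln_b: "integrable \<nu>S (\<lambda>s. ln (b s))"
proof -
  interpret nuS: prob_space \<nu>S by (rule prob_space_nuS)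
  have "AE s in \<nu>S. norm (ln (b s)) \<le> - ln \<eta>"
    using AE_nuS AE_space
  proof eventually_elim
    case (elim s)
    then have "ln \<eta> \<le> ln (b s)" "ln (b s) \<le> 0"
      using eta(1) b_bounds(2)[of s] by (auto intro!: ln_le_zero_iff[THEN iffD2])
    then show ?case by simp
  qed
  then show ?thesis by (intro nuS.integrable_const_bound) auto
qed

lemma KL_nuS: "KL \<nu>S M = ereal ((\<integral>s. ln (b s) \<partial>\<nu>S) - ln a)"
proof -
  interpret nuS: prob_space \<nu>S by (rule prob_space_nuS)
  have ae: "AE s in \<nu>S. ln (b s) - ln a = ln (b s / a)"
    using AE_nuS by eventually_elim (use eta(1) a_pos in \<open>simp add: ln_div\<close>)
  have int: "integrable \<nu>S (\<lambda>s. ln (b s) - ln a)"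
    using integrable_ln_b by simp
  have int': "integrable \<nu>S (\<lambda>s. ln (b s / a))"
    by (rule integrable_cong_AE_imp[OF int]) (use ae in \<open>auto elim!: eventually_mono\<close>)
  have "KL \<nu>S M = ereal (\<integral>s. ln (b s / a) \<partial>\<nu>S)"
    by (rule KL_density_eq[OF prob_space_axioms prob_space_nuS _ _ nuS_eq int']) (use a_pos b_bounds(1) in auto)
  also have "(\<integral>s. ln (b s / a) \<partial>\<nu>S) = (\<integral>s. ln (b s) - ln a \<partial>\<nu>S)"
    by (rule integral_cong_AE) (use ae in \<open>auto elim!: eventually_mono\<close>)
  also have "\<dots> = (\<integral>s. ln (b s) \<partial>\<nu>S) - ln a"
    using integrable_ln_b nuS.prob_space by simp
  finally show ?thesis .
qed

text \<open>The marginal density \<open>b s / a\<close> times the indicator over \<open>b s\<close>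
  is the indicator over \<open>a\<close>. The cancellation is legitimate because \<open>b\<close> is
  positive on samples met by \<open>A\<close>.\<close>

lemma nu_eq_density: "\<nu> = density (kjoint \<nu>S N K) (\<lambda>x. ennreal (indicator A x / b (fst x)))"
proof (rule measure_eqI_nn_integral)
  note sk = sets_kjoint_nuS[where q = K and H = N]
  note sk[measurable_cong]
  show "sets \<nu> = sets (density (kjoint \<nu>S N K) (\<lambda>x. ennreal (indicator A x / b (fst x))))"
    by (simp add: sets_nu sk)
  fix h :: "_ \<Rightarrow> ennreal"
  assume "h \<in> borel_measurable (density (kjoint \<nu>S N K) (\<lambda>x. ennreal (indicator A x / b (fst x))))"
  then have h[measurable]: "h \<in> borel_measurable (M \<Otimes>\<^sub>M N)"
    by (simp add: measurable_cong_sets[OF sk refl])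
  have "(\<integral>\<^sup>+ x. h x \<partial>density (kjoint \<nu>S N K) (\<lambda>x. ennreal (indicator A x / b (fst x))))
      = (\<integral>\<^sup>+ x. ennreal (indicator A x / b (fst x)) * h x \<partial>kjoint \<nu>S N K)"
    by (rule nn_integral_density) measurable
  also have "\<dots> = (\<integral>\<^sup>+ s. \<integral>\<^sup>+ w. ennreal (indicator A (s, w) / b s) * h (s, w) \<partial>K s \<partial>\<nu>S)"
    by (subst nn_integral_kjoint[OF K_nuS]) simp_all
  also have "\<dots> = (\<integral>\<^sup>+ s. ennreal (b s / a) * (\<integral>\<^sup>+ w. ennreal (indicator A (s, w) / b s) * h (s, w) \<partial>K s) \<partial>M)"
    using kernel_nn_integral_measurable[OF K, of "\<lambda>x. ennreal (indicator A x / b (fst x)) * h x"]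
    by (intro nn_integral_nuS) simp
  also have "\<dots> = (\<integral>\<^sup>+ s. \<integral>\<^sup>+ w. ennreal (indicator A (s, w) / a) * h (s, w) \<partial>K s \<partial>M)"
  proof (rule nn_integral_cong)
    fix s assume s: "s \<in> space M"
    note [measurable] = indicator_section_measurable[OF s] kernel_section_measurable[OF K s h]
    have "ennreal (b s / a) * (\<integral>\<^sup>+ w. ennreal (indicator A (s, w) / b s) * h (s, w) \<partial>K s)
      = (\<integral>\<^sup>+ w. ennreal (b s / a) * (ennreal (indicator A (s, w) / b s) * h (s, w)) \<partial>K s)"
      by (rule nn_integral_cmult[symmetric]) measurable
    also have "\<dots> = (\<integral>\<^sup>+ w. ennreal (indicator A (s, w) / a) * h (s, w) \<partial>K s)"
    proof (rule nn_integral_cong)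
      fix w
      show "ennreal (b s / a) * (ennreal (indicator A (s, w) / b s) * h (s, w))
          = ennreal (indicator A (s, w) / a) * h (s, w)"
      proof (cases "(s, w) \<in> A")
        case True
        then have "0 < b s" using A_imp eta(1) by fastforce
        then show ?thesis
          using True a_pos by (simp add: mult.assoc[symmetric] ennreal_mult'[symmetric])
      qed simp
    qed
    finally show "ennreal (b s / a) * (\<integral>\<^sup>+ w. ennreal (indicator A (s, w) / b s) * h (s, w) \<partial>K s)
      = (\<integral>\<^sup>+ w. ennreal (indicator A (s, w) / a) * h (s, w) \<partial>K s)" .
  qed
  also have "\<dots> = (\<integral>\<^sup>+ x. h x \<partial>\<nu>)"
    by (rule nn_integral_nu[symmetric]) measurable
  finally show "(\<integral>\<^sup>+ x. h x \<partial>\<nu>) =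
    (\<integral>\<^sup>+ x. h x \<partial>density (kjoint \<nu>S N K) (\<lambda>x. ennreal (indicator A x / b (fst x))))" ..
qed

text \<open>The log-density is \<open>- ln (b s)\<close> on \<open>A\<close>. Together with
  \<open>KL_nuS\<close> this sums to \<open>- ln a\<close>, the chain rule for the conditioned
  law.\<close>

lemma KL_nu_K: "KL \<nu> (kjoint \<nu>S N K) = ereal (- (\<integral>s. ln (b s) \<partial>\<nu>S))"
proof -
  interpret nu: prob_space \<nu> by (rule prob_space_nu)
  note sk = sets_kjoint_nuS[where q = K and H = N]
  note sk[measurable_cong]
  have ae: "AE x in \<nu>. - ln (b (fst x)) = ln (indicator A x / b (fst x))"
    using AE_nu
  proof eventually_elim
    case (elim x)
    then have "0 < b (fst x)" using A_imp[of "fst x" "snd x"] eta(1) by simp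
    then show ?case using elim by (simp add: ln_div)
  qed
  have fst_m: "fst \<in> \<nu> \<rightarrow>\<^sub>M M" by measurable
  have int: "integrable \<nu> (\<lambda>x. - ln (b (fst x)))"
    using integrable_ln_b unfolding \<nu>S_def by (subst (asm) integrable_distr_eq[OF fst_m]) auto
  have int': "integrable \<nu> (\<lambda>x. ln (indicator A x / b (fst x)))"
    by (rule integrable_cong_AE_imp[OF int]) (use ae in \<open>auto elim!: eventually_mono\<close>)
  have "KL \<nu> (kjoint \<nu>S N K) = ereal (\<integral>x. ln (indicator A x / b (fst x)) \<partial>\<nu>)"
    by (rule KL_density_eq[OF prob_space_kjoint[OF prob_space_nuS K_nuS] prob_space_nu _ _ nu_eq_density int'])
       (use b_bounds(1) in auto)
  also have "(\<integral>x. ln (indicator A x / b (fst x)) \<partial>\<nu>) = (\<integral>x. - ln (b (fst x)) \<partial>\<nu>)"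
    by (rule integral_cong_AE) (use ae in \<open>auto elim!: eventually_mono\<close>)
  also have "\<dots> = - (\<integral>s. ln (b s) \<partial>\<nu>S)"
    unfolding \<nu>S_def by (subst integral_distr[OF fst_m]) simp_all
  finally show ?thesis .
qed

section \<open>Conditional law of the hypothesis given the sample\<close>

lemma prob_space_kappa:
  assumes s: "s \<in> space M"
  shows "prob_space (\<kappa> s)" "sets (\<kappa> s) = sets N"
proof -
  show "sets (\<kappa> s) = sets N" by (simp add: \<kappa>_def sets_K[OF s])
  show "prob_space (\<kappa> s)"
  proof (cases "0 < b s")
    case True
    note [measurable] = indicator_section_measurable[OF s]
    have "emeasure (\<kappa> s) (space (\<kappa> s)) = (\<integral>\<^sup>+ w. ennreal (indicator A (s, w) / b s) \<partial>K s)"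
      using True by (simp add: \<kappa>_def emeasure_density)
    also have "\<dots> = (\<integral>\<^sup>+ w. ennreal (1 / b s) * ennreal (indicator A (s, w)) \<partial>K s)"
      by (intro nn_integral_cong) (auto simp: indicator_def)
    also have "\<dots> = ennreal (1 / b s) * ennreal (b s)"
      by (simp add: nn_integral_cmult nn_integral_K_A s)
    also have "\<dots> = 1" using True by (simp add: ennreal_mult'[symmetric])
    finally show ?thesis by (rule prob_spaceI)
  qed (simp add: \<kappa>_def kernels_prob_space(1)[OF K s])
qed

lemma nn_integral_kappa:
  assumes s: "s \<in> space M" and h: "h \<in> borel_measurable N"
  shows "(\<integral>\<^sup>+ w. h w \<partial>\<kappa> s) =
    (if 0 < b s then \<integral>\<^sup>+ w. ennreal (indicator A (s, w) / b s) * h w \<partial>K s else \<integral>\<^sup>+ w. h w \<partial>K s)"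
proof -
  note [measurable] = indicator_section_measurable[OF s]
  have [measurable]: "h \<in> borel_measurable (K s)"
    using h by (simp add: measurable_cong_sets[OF sets_K[OF s] refl])
  show ?thesis by (auto simp: \<kappa>_def intro!: nn_integral_density)
qed

text \<open>The mass of a fixed set is a measurable case distinction on \<open>b\<close> between two
  kernel integrals over \<open>K\<close>.\<close>

lemma kappa_kernel: "\<kappa> \<in> kernels M N"
  unfolding kernels_def
proof (intro measurable_prob_algebraI measurable_subprob_algebra prob_space_kappa prob_space_imp_subprob_space)
  fix B assume B[measurable]: "B \<in> sets N"
  have [measurable]: "(\<lambda>s. \<integral>\<^sup>+ w. ennreal (indicator A (s, w) / b s) * indicator B w \<partial>K s) \<in> borel_measurable M"
    using kernel_nn_integral_measurable[OF K, of "\<lambda>x. ennreal (indicator A x / b (fst x)) * indicator B (snd x)"]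
    by simp
  have [measurable]: "(\<lambda>s. \<integral>\<^sup>+ w. indicator B w \<partial>K s) \<in> borel_measurable M"
    using kernel_nn_integral_measurable[OF K, of "\<lambda>x. indicator B (snd x)"] by simp
  have "(\<lambda>s. if 0 < b s then \<integral>\<^sup>+ w. ennreal (indicator A (s, w) / b s) * indicator B w \<partial>K s
      else \<integral>\<^sup>+ w. indicator B w \<partial>K s) \<in> borel_measurable M"
    by measurable
  then show "(\<lambda>s. emeasure (\<kappa> s) B) \<in> borel_measurable M"
  proof (rule measurable_cong[THEN iffD1, rotated])
    fix s assume s: "s \<in> space M"
    show "(if 0 < b s then \<integral>\<^sup>+ w. ennreal (indicator A (s, w) / b s) * indicator B w \<partial>K s
      else \<integral>\<^sup>+ w. indicator B w \<partial>K s) = emeasure (\<kappa> s) B"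
      using nn_integral_kappa[OF s, of "indicator B"] B prob_space_kappa(2)[OF s] by simp
  qed
qed

text \<open>Makes \<open>\<kappa>\<close> an admissible conditional of \<open>\<nu>\<close> in
  condition (ii). Only samples with \<open>b s > 0\<close> matter, and on them
  \<open>\<kappa> s\<close> has the density from \<open>nu_eq_density\<close>.\<close>

lemma nu_eq_kjoint_kappa: "\<nu> = kjoint \<nu>S N \<kappa>"
proof (rule measure_eqI_nn_integral)
  note sk = sets_kjoint_nuS[where q = \<kappa> and H = N]
  show "sets \<nu> = sets (kjoint \<nu>S N \<kappa>)" by (simp add: sets_nu sk)
  fix h :: "_ \<Rightarrow> ennreal" assume "h \<in> borel_measurable (kjoint \<nu>S N \<kappa>)"
  then have h[measurable]: "h \<in> borel_measurable (M \<Otimes>\<^sub>M N)"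
    by (simp add: measurable_cong_sets[OF sk refl])
  have kap: "\<kappa> \<in> kernels \<nu>S N"
    using kappa_kernel kernels_cong_sets[of \<nu>S M N] by simp
  note sets_kjoint_nuS[measurable_cong]
  have "(\<integral>\<^sup>+ x. h x \<partial>\<nu>) = (\<integral>\<^sup>+ x. ennreal (indicator A x / b (fst x)) * h x \<partial>kjoint \<nu>S N K)"
    by (subst nu_eq_density, rule nn_integral_density) measurable
  also have "\<dots> = (\<integral>\<^sup>+ s. \<integral>\<^sup>+ w. ennreal (indicator A (s, w) / b s) * h (s, w) \<partial>K s \<partial>\<nu>S)"
    by (subst nn_integral_kjoint[OF K_nuS]) simp_all
  also have "\<dots> = (\<integral>\<^sup>+ s. \<integral>\<^sup>+ w. h (s, w) \<partial>\<kappa> s \<partial>\<nu>S)"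
  proof (rule nn_integral_cong_AE)
    show "AE s in \<nu>S. (\<integral>\<^sup>+ w. ennreal (indicator A (s, w) / b s) * h (s, w) \<partial>K s) = (\<integral>\<^sup>+ w. h (s, w) \<partial>\<kappa> s)"
      using AE_nuS AE_space
    proof eventually_elim
      case (elim s)
      then have "s \<in> space M" by simp
      moreover have "0 < b s" using elim(1) eta(1) by simp
      ultimately show ?case
        using measurable_compose[OF measurable_Pair1' h] by (simp add: nn_integral_kappa)
    qed
  qed
  also have "\<dots> = (\<integral>\<^sup>+ x. h x \<partial>kjoint \<nu>S N \<kappa>)"
    by (rule nn_integral_kjoint[OF kap, symmetric]) simp
  finally show "(\<integral>\<^sup>+ x. h x \<partial>\<nu>) = (\<integral>\<^sup>+ x. h x \<partial>kjoint \<nu>S N \<kappa>)" .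
qed

lemma AE_kappa:
  assumes s: "s \<in> space M" and "0 < b s"
  shows "AE w in \<kappa> s. (s, w) \<in> A"
proof -
  note [measurable] = indicator_section_measurable[OF s]
  have eq: "\<kappa> s = density (K s) (\<lambda>w. ennreal (indicator A (s, w) / b s))"
    using assms(2) by (simp add: \<kappa>_def)
  show ?thesis
    unfolding eq by (subst AE_density, measurable) (auto simp: indicator_def split: if_splits)
qed

section \<open>Change of measure back to the sample law\<close>

text \<open>The weight inverts the density \<open>b s / a\<close> of \<open>\<nu>S\<close>. Samples
  with \<open>b s = 0\<close> are lost, hence only an inequality.\<close>

lemma nn_integral_reweight_le:
  assumes q: "q \<in> kernels M H" and h[measurable]: "h \<in> borel_measurable (M \<Otimes>\<^sub>M H)"
  shows "(\<integral>\<^sup>+ x. ennreal (a / b (fst x)) * h x \<partial>kjoint \<nu>S H q) \<le> (\<integral>\<^sup>+ x. h x \<partial>kjoint M H q)"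
proof -
  have q': "q \<in> kernels \<nu>S H"
    using q kernels_cong_sets[of \<nu>S M H] by simp
  have "(\<integral>\<^sup>+ x. ennreal (a / b (fst x)) * h x \<partial>kjoint \<nu>S H q)
      = (\<integral>\<^sup>+ s. \<integral>\<^sup>+ y. ennreal (a / b s) * h (s, y) \<partial>q s \<partial>\<nu>S)"
    by (subst nn_integral_kjoint[OF q']) simp_all
  also have "\<dots> = (\<integral>\<^sup>+ s. ennreal (b s / a) * (\<integral>\<^sup>+ y. ennreal (a / b s) * h (s, y) \<partial>q s) \<partial>M)"
    using kernel_nn_integral_measurable[OF q, of "\<lambda>x. ennreal (a / b (fst x)) * h x"]
    by (intro nn_integral_nuS) simp
  also have "\<dots> \<le> (\<integral>\<^sup>+ s. \<integral>\<^sup>+ y. h (s, y) \<partial>q s \<partial>M)"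
  proof (rule nn_integral_mono)
    fix s assume s: "s \<in> space M"
    note [measurable] = kernel_section_measurable[OF q s h]
    have "ennreal (b s / a) * (\<integral>\<^sup>+ y. ennreal (a / b s) * h (s, y) \<partial>q s)
      = ennreal (b s / a) * ennreal (a / b s) * (\<integral>\<^sup>+ y. h (s, y) \<partial>q s)"
      by (subst nn_integral_cmult) (auto simp: mult.assoc)
    also have "\<dots> \<le> 1 * (\<integral>\<^sup>+ y. h (s, y) \<partial>q s)"
      using a_pos b_bounds(1)[of s]
      by (intro mult_right_mono) (auto simp: ennreal_mult'[symmetric])
    finally show "ennreal (b s / a) * (\<integral>\<^sup>+ y. ennreal (a / b s) * h (s, y) \<partial>q s) \<le> (\<integral>\<^sup>+ y. h (s, y) \<partial>q s)"
      by simp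
  qed
  also have "\<dots> = (\<integral>\<^sup>+ x. h x \<partial>kjoint M H q)"
    by (rule nn_integral_kjoint[OF q, symmetric]) simp
  finally show ?thesis .
qed

lemma AE_kjoint_nuS:
  assumes q: "q \<in> kernels M H" and ae: "AE s in \<nu>S. Q s"
  shows "AE x in kjoint \<nu>S H q. Q (fst x)"
proof -
  have q': "q \<in> kernels \<nu>S H" using q kernels_cong_sets[of \<nu>S M H] by simp
  note sets_kjoint_nuS[measurable_cong]
  have "AE s in distr (kjoint \<nu>S H q) \<nu>S fst. Q s"
    unfolding distr_kjoint_fst[OF prob_space_nuS q'] by (rule ae)
  then show ?thesis by (rule AE_distrD[rotated]) measurable
qed

section \<open>Lower bound under condition (i)\<close>

text \<open>Donsker-Varadhan for the joint laws of \<open>p\<close> and \<open>q\<close> over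
  \<open>\<nu>S\<close>, with \<open>l * g\<close> tilted by the log-density of
  \<open>\<nu>S\<close>. The tilt has mean KL(\<open>\<nu>S\<close>, \<open>M\<close>) =
  \<open>B - ln a\<close>, and \<open>B\<close> is exactly - KL(\<open>\<nu>\<close>,
  \<open>kjoint \<nu>S N K\<close>). The constraint \<open>E\<close> then replaces the mean of
  \<open>g\<close> by that of \<open>D\<close> minus \<open>\<epsilon>\<close>.\<close>

lemma Tfun_1_bound:
  fixes D :: "'s \<times> 'w \<Rightarrow> real" and g :: "'s \<times> 'h \<Rightarrow> real"
  assumes D[measurable]: "D \<in> borel_measurable (M \<Otimes>\<^sub>M N)"
    and g[measurable]: "g \<in> borel_measurable (M \<Otimes>\<^sub>M H)"
    and p: "p \<in> kernels M H" and q: "q \<in> kernels M H" and l: "0 < l"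
    and D_bound: "\<And>x. x \<in> A \<Longrightarrow> 0 \<le> D x \<and> D x \<le> C"
    and E: "Eext (kjoint3 \<nu> H p) (\<lambda>x. ereal (D (fst x) - g (fst (fst x), snd x))) \<le> ereal \<epsilon>"
  shows "ereal (ln a) \<le> Tfun 1 M \<nu>S H p q (\<lambda>x. l * g x) - KL \<nu> (kjoint \<nu>S N K)
    - ereal l * (Eext \<nu> (\<lambda>x. ereal (D x)) - ereal \<epsilon>)"
proof -
  interpret nu: prob_space \<nu> by (rule prob_space_nu)
  interpret nuS: prob_space \<nu>S by (rule prob_space_nuS)
  define B where "B = (\<integral>s. ln (b s) \<partial>\<nu>S)"
  define Q where "Q = kjoint \<nu>S H p"
  define R where "R = kjoint \<nu>S H q"
  define Q3 where "Q3 = kjoint3 \<nu> H p"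
  define c where "c = (\<integral>\<^sup>+ x. ennreal (exp (l * g x)) \<partial>kjoint M H q)"
  have T: "Tfun 1 M \<nu>S H p q (\<lambda>x. l * g x) = KL Q R + ln_enn c"
    by (simp add: Tfun_def Q_def R_def c_def)
  have pq': "p \<in> kernels \<nu>S H" "q \<in> kernels \<nu>S H"
    using p q kernels_cong_sets[of \<nu>S M H] by simp_all
  have probQ: "prob_space Q" unfolding Q_def by (rule prob_space_kjoint[OF prob_space_nuS pq'(1)])
  have probR: "prob_space R" unfolding R_def by (rule prob_space_kjoint[OF prob_space_nuS pq'(2)])
  interpret Q: prob_space Q by (rule probQ)
  have setsQ[measurable_cong]: "sets Q = sets (M \<Otimes>\<^sub>M H)" unfolding Q_def by (rule sets_kjoint_nuS)
  have setsR[measurable_cong]: "sets R = sets (M \<Otimes>\<^sub>M H)" unfolding R_def by (rule sets_kjoint_nuS)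
  have D_ae: "AE x in \<nu>. 0 \<le> D x \<and> D x \<le> C"
    using AE_nu by eventually_elim (rule D_bound)
  have intD: "integrable \<nu> D"
    by (rule nu.integrable_const_bound[where B = C], rule eventually_mono[OF D_ae]) auto
  define ED where "ED = integral\<^sup>L \<nu> D"
  have ED: "Eext \<nu> (\<lambda>x. ereal (D x)) = ereal ED"
    using Eext_integrable[OF intD] by (simp add: ED_def)
  have KL_K: "KL \<nu> (kjoint \<nu>S N K) = ereal (- B)" by (simp add: KL_nu_K B_def)
  show ?thesis
  proof (cases "KL Q R = \<infinity> \<or> c = \<top>")
    \<comment> \<open>A sum in \<open>ereal\<close> with a summand \<infinity> is \<infinity>, and
      the subtracted terms are real.\<close>
    case True
    then have inf: "KL Q R + ln_enn c = \<infinity>" by (auto simp: ln_enn_def)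
    show ?thesis unfolding T inf by (simp add: ED KL_K)
  next
    case False
    then have fin: "KL Q R < \<infinity>" by (simp add: less_top)
    obtain k where k: "KL Q R = ereal k"
      using KL_finite_integrable(4)[OF probR probQ fin] by blast
    obtain c' where c': "0 \<le> c'" "c = ennreal c'"
      using False by (metis ennreal_cases)
    interpret Pq: prob_space "kjoint M H q" by (rule prob_space_kjoint[OF prob_space_axioms q])
    have "0 < c"
      unfolding c_def
      by (rule Pq.nn_integral_exp_pos)
         (simp add: measurable_cong_sets[OF sets_kjoint[OF not_empty] refl])
    with c' have c0: "0 < c'" by simp
    have ln_c: "ln_enn c = ereal (ln c')" using c0 by (simp add: c'(2) ln_enn_def)

    have k3: "(\<lambda>sw. p (fst sw)) \<in> kernels \<nu> H"
      and d3: "distr Q3 (M \<Otimes>\<^sub>M H) (\<lambda>x. (fst (fst x), snd x)) = Q"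
      using distr_kjoint3[OF prob_space_nu sets_nu p] by (simp_all add: Q3_def Q_def \<nu>S_def)
    have sets3[measurable_cong]: "sets Q3 = sets ((M \<Otimes>\<^sub>M N) \<Otimes>\<^sub>M H)"
      unfolding Q3_def kjoint3_eq_kjoint
      by (subst sets_kjoint) (auto simp: nu.not_empty intro!: sets_pair_measure_cong sets_nu)
    have d3': "distr Q3 \<nu> fst = \<nu>"
      unfolding Q3_def kjoint3_eq_kjoint by (rule distr_kjoint_fst[OF prob_space_nu k3])
    have proj[measurable]: "(\<lambda>x. (fst (fst x), snd x)) \<in> Q3 \<rightarrow>\<^sub>M M \<Otimes>\<^sub>M H" by measurable
    have fst3[measurable]: "fst \<in> Q3 \<rightarrow>\<^sub>M \<nu>" by measurable

    \<comment> \<open>\<open>J\<close> is the log-density of \<open>\<nu>S\<close> with respect to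
      \<open>M\<close>, read on pairs.\<close>
    define J where "J x = ln (b (fst x)) - ln a" for x :: "'s \<times> 'h"
    have J_m[measurable]: "J \<in> borel_measurable (M \<Otimes>\<^sub>M H)"
      unfolding J_def by measurable
    have fstQ: "fst \<in> Q \<rightarrow>\<^sub>M \<nu>S" by measurable
    have dQ: "distr Q \<nu>S fst = \<nu>S"
      unfolding Q_def by (rule distr_kjoint_fst[OF prob_space_nuS pq'(1)])
    have int_lnb: "integrable Q (\<lambda>x. ln (b (fst x)))"
      using integrable_ln_b integrable_distr_eq[OF fstQ, of "\<lambda>s. ln (b s)"] dQ by simp
    have "(\<integral>x. ln (b (fst x)) \<partial>Q) = B"
      using integral_distr[OF fstQ, of "\<lambda>s. ln (b s)"] dQ by (simp add: B_def)
    then have int_J: "integrable Q J" "integral\<^sup>L Q J = B - ln a"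
      using int_lnb Q.prob_space by (simp_all add: J_def[abs_def])

    \<comment> \<open>Integrability of \<open>g\<close> is not assumed. Its negative part is
      controlled by \<open>E\<close>: on the support of \<open>\<nu>\<close> the function
      \<open>D\<close> is nonnegative, so \<open>- g\<close> is at most \<open>D - g\<close>, whose
      positive part has finite integral.\<close>
    have "(\<integral>\<^sup>+ x. ennreal (- g x) \<partial>Q) = (\<integral>\<^sup>+ x. ennreal (- g (fst (fst x), snd x)) \<partial>Q3)"
      unfolding d3[symmetric] by (rule nn_integral_distr[OF proj]) measurable
    also have "\<dots> \<le> (\<integral>\<^sup>+ x. ennreal (D (fst x) - g (fst (fst x), snd x)) \<partial>Q3)"
    proof (rule nn_integral_mono_AE)
      have "AE x in Q3. 0 \<le> D (fst x) \<and> D (fst x) \<le> C"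
        by (rule AE_distrD[OF fst3], unfold d3', rule D_ae)
      then show "AE x in Q3. ennreal (- g (fst (fst x), snd x)) \<le> ennreal (D (fst x) - g (fst (fst x), snd x))"
        by eventually_elim (auto intro!: ennreal_leI)
    qed
    also have "\<dots> < \<infinity>"
      using Eext_less_top_imp[OF le_less_trans[OF E]] by (simp add: Q3_def)
    finally have g_neg: "(\<integral>\<^sup>+ x. ennreal (- g x) \<partial>Q) < \<infinity>" .

    \<comment> \<open>Subtracting \<open>J\<close> multiplies the exponential by
      \<open>a / b\<close>, which turns the moment under \<open>R\<close> into one bounded by the
      moment \<open>c\<close> over \<open>M\<close>.\<close>
    define G where "G x = l * g x - J x" for x
    have G_m[measurable]: "G \<in> borel_measurable (M \<Otimes>\<^sub>M H)"
      unfolding G_def by measurable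
    have "(\<integral>\<^sup>+ x. ennreal (exp (G x)) \<partial>R) = (\<integral>\<^sup>+ x. ennreal (a / b (fst x)) * ennreal (exp (l * g x)) \<partial>R)"
    proof (rule nn_integral_cong_AE)
      have "AE x in R. \<eta> \<le> b (fst x)"
        unfolding R_def by (rule AE_kjoint_nuS[OF q AE_nuS])
      then show "AE x in R. ennreal (exp (G x)) = ennreal (a / b (fst x)) * ennreal (exp (l * g x))"
      proof eventually_elim
        case (elim x)
        then have "0 < b (fst x)" using eta(1) by simp
        then show ?case
          using a_pos by (simp add: G_def J_def exp_diff ennreal_mult'[symmetric])
      qed
    qed
    also have "\<dots> \<le> c"
      unfolding R_def c_def by (rule nn_integral_reweight_le[OF q]) measurable
    finally have exp_G: "(\<integral>\<^sup>+ x. ennreal (exp (G x)) \<partial>R) \<le> ennreal c'" by (simp add: c'(2))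
    have "(\<integral>\<^sup>+ x. ennreal (- G x) \<partial>Q) \<le> (\<integral>\<^sup>+ x. ennreal l * ennreal (- g x) + ennreal (J x) \<partial>Q)"
    proof (rule nn_integral_mono)
      fix x
      show "ennreal (- G x) \<le> ennreal l * ennreal (- g x) + ennreal (J x)"
        using ennreal_add_le[of "l * - g x" "J x"] l by (simp add: G_def ennreal_mult'[symmetric])
    qed
    also have "\<dots> = ennreal l * (\<integral>\<^sup>+ x. ennreal (- g x) \<partial>Q) + (\<integral>\<^sup>+ x. ennreal (J x) \<partial>Q)"
      by (subst nn_integral_add) (auto simp: nn_integral_cmult)
    also have "\<dots> < \<infinity>"
      using g_neg int_J(1) by (auto simp: real_integrable_def ennreal_mult_less_top less_top)
    finally have G_neg: "(\<integral>\<^sup>+ x. ennreal (- G x) \<partial>Q) < \<infinity>" .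
    have G_R: "G \<in> borel_measurable R" by measurable
    note DV = Donsker_Varadhan[OF probR probQ fin G_R c0 exp_G G_neg]
    have "integrable Q (\<lambda>x. (G x + J x) / l)"
      using DV(1) int_J(1) by simp
    then have int_g: "integrable Q g"
      using l by (simp add: G_def)
    have "integral\<^sup>L Q G = l * integral\<^sup>L Q g - (B - ln a)"
      using int_g int_J by (simp add: G_def[abs_def])
    then have upper: "l * integral\<^sup>L Q g \<le> k + ln c' + B - ln a"
      using DV(2) by (simp add: k)
    have int_g3: "integrable Q3 (\<lambda>x. g (fst (fst x), snd x))"
      using int_g integrable_distr_eq[OF proj, of g] by (simp add: d3)
    have int_D3: "integrable Q3 (\<lambda>x. D (fst x))"
      using intD integrable_distr_eq[OF fst3, of D] by (simp add: d3')
    \<comment> \<open>With \<open>g\<close> now known to be integrable, the extended expectation in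
      \<open>E\<close> splits into a difference of real means.\<close>
    have "Eext Q3 (\<lambda>x. ereal (D (fst x) - g (fst (fst x), snd x))) = ereal (ED - integral\<^sup>L Q g)"
      using Eext_integrable[OF Bochner_Integration.integrable_diff[OF int_D3 int_g3]]
        int_D3 int_g3 integral_distr[OF proj, of g] integral_distr[OF fst3, of D]
      by (simp add: d3 d3' ED_def)
    then have "ED - \<epsilon> \<le> integral\<^sup>L Q g"
      using E by (simp add: Q3_def)
    then have "l * (ED - \<epsilon>) \<le> l * integral\<^sup>L Q g" using l by simp
    with upper have "ln a \<le> k + ln c' + B - l * (ED - \<epsilon>)" by simp
    then show ?thesis by (simp add: T ED KL_K k ln_c)
  qed
qed

section \<open>Lower bound under condition (ii)\<close>

text \<open>For each sample the variational bound gives \<open>l * ln (d s) - ln (e s)\<close> below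
  the Renyi divergence, with \<open>e s\<close> the inner moment of \<open>f powr l\<close>. After
  averaging over \<open>\<nu>S\<close>, Donsker-Varadhan for \<open>\<nu>S\<close> against
  \<open>M\<close> bounds the mean of \<open>ln (e s)\<close> by \<open>B - ln a\<close> plus
  \<open>ln c'\<close>.\<close>

lemma Tfun_Renyi_bound:
  fixes f D :: "'s \<times> 'w \<Rightarrow> real"
  assumes f[measurable]: "f \<in> borel_measurable (M \<Otimes>\<^sub>M N)"
    and D[measurable]: "D \<in> borel_measurable (M \<Otimes>\<^sub>M N)"
    and f_pos: "\<And>x. x \<in> space (M \<Otimes>\<^sub>M N) \<Longrightarrow> 0 < f x"
    and q: "q \<in> kernels M N" and \<alpha>: "1 < \<alpha>" and l: "\<alpha> / (\<alpha> - 1) \<le> l"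
    and D_bound: "\<And>x. x \<in> A \<Longrightarrow> exp (- C) \<le> D x \<and> D x \<le> exp C \<and> D x \<le> f x"
  shows "ereal (ln a) \<le> Tfun \<alpha> M \<nu>S N \<kappa> q (\<lambda>x. l * ln (f x)) - KL \<nu> (kjoint \<nu>S N K)
    - ereal l * Eext \<nu>S (\<lambda>s. ln_enn (\<integral>\<^sup>+ w. ennreal (D (s, w)) \<partial>\<kappa> s))"
proof -
  interpret nuS: prob_space \<nu>S by (rule prob_space_nuS)
  define B where "B = (\<integral>s. ln (b s) \<partial>\<nu>S)"
  have KL_K: "KL \<nu> (kjoint \<nu>S N K) = ereal (- B)" by (simp add: KL_nu_K B_def)
  define c where "c = (\<integral>\<^sup>+ x. ennreal (exp (l * ln (f x))) \<partial>kjoint M N q)"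
  define cs where "cs s = (\<integral>\<^sup>+ w. ennreal (exp (l * ln (f (s, w)))) \<partial>q s)" for s
  define Ren where "Ren = Eext \<nu>S (\<lambda>s. Renyi \<alpha> (\<kappa> s) (q s))"
  have T: "Tfun \<alpha> M \<nu>S N \<kappa> q (\<lambda>x. l * ln (f x)) = Ren + ln_enn c"
    using \<alpha> by (simp add: Tfun_def Ren_def c_def)
  have cs_m[measurable]: "cs \<in> borel_measurable M"
    unfolding cs_def using kernel_nn_integral_measurable[OF q, of "\<lambda>x. ennreal (exp (l * ln (f x)))"] by simp
  have c_eq: "c = (\<integral>\<^sup>+ s. cs s \<partial>M)"
    unfolding c_def cs_def by (rule nn_integral_kjoint[OF q]) measurable
  define d where "d s = enn2real (\<integral>\<^sup>+ w. ennreal (D (s, w)) \<partial>\<kappa> s)" for s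
  have d_m[measurable]: "d \<in> borel_measurable M"
    unfolding d_def using kernel_nn_integral_measurable[OF kappa_kernel, of "\<lambda>x. ennreal (D x)"] by simp
  \<comment> \<open>For almost every sample \<open>\<kappa> s\<close> is carried by the section of
    \<open>A\<close>, so the mean of \<open>D\<close> inherits the bounds \<open>exp (- C)\<close>
    and \<open>exp C\<close>.\<close>
  have d_ae: "AE s in \<nu>S. (\<integral>\<^sup>+ w. ennreal (D (s, w)) \<partial>\<kappa> s) = ennreal (d s) \<and> exp (- C) \<le> d s \<and> d s \<le> exp C"
    using AE_nuS AE_space
  proof eventually_elim
    case (elim s)
    then have s: "s \<in> space M" and bs: "0 < b s" using eta(1) by simp_all
    interpret ks: prob_space "\<kappa> s" by (rule prob_space_kappa[OF s])
    let ?I = "\<integral>\<^sup>+ w. ennreal (D (s, w)) \<partial>\<kappa> s"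
    have ae: "AE w in \<kappa> s. exp (- C) \<le> D (s, w) \<and> D (s, w) \<le> exp C"
      using AE_kappa[OF s bs] by eventually_elim (use D_bound in blast)
    have "(\<integral>\<^sup>+ w. ennreal (exp (- C)) \<partial>\<kappa> s) \<le> ?I"
      using ae by (intro nn_integral_mono_AE) (auto simp: ennreal_leI elim!: eventually_mono)
    then have lo: "ennreal (exp (- C)) \<le> ?I" by (simp add: ks.emeasure_space_1)
    have "?I \<le> (\<integral>\<^sup>+ w. ennreal (exp C) \<partial>\<kappa> s)"
      using ae by (intro nn_integral_mono_AE) (auto simp: ennreal_leI elim!: eventually_mono)
    then have hi: "?I \<le> ennreal (exp C)" by (simp add: ks.emeasure_space_1)
    then have eq: "?I = ennreal (d s)"
      unfolding d_def by (metis ennreal_enn2real ennreal_less_top le_less_trans)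
    then show ?case using lo hi
      by (metis d_def enn2real_nonneg ennreal_le_iff exp_ge_zero)
  qed
  have int_d: "integrable \<nu>S (\<lambda>s. ln (d s))"
  proof (rule nuS.integrable_const_bound[where B = "C"])
    show "AE s in \<nu>S. norm (ln (d s)) \<le> C"
      using d_ae
    proof eventually_elim
      case (elim s)
      have "0 < d s" using elim exp_gt_zero[of "- C"] by linarith
      moreover from this have "ln (d s) \<le> C" "- C \<le> ln (d s)"
        using elim ln_le_cancel_iff[of "d s" "exp C"] by (simp_all add: ln_ge_iff)
      ultimately show ?case by (simp add: abs_le_iff)
    qed
  qed measurable
  define L where "L = (\<integral>s. ln (d s) \<partial>\<nu>S)"
  have "Eext \<nu>S (\<lambda>s. ln_enn (\<integral>\<^sup>+ w. ennreal (D (s, w)) \<partial>\<kappa> s)) = Eext \<nu>S (\<lambda>s. ereal (ln (d s)))"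
  proof (rule Eext_cong_AE)
    show "AE s in \<nu>S. ln_enn (\<integral>\<^sup>+ w. ennreal (D (s, w)) \<partial>\<kappa> s) = ereal (ln (d s))"
      using d_ae
    proof eventually_elim
      case (elim s)
      moreover have "0 < d s" using elim exp_gt_zero[of "- C"] by linarith
      ultimately show ?case by (simp add: ln_enn_def)
    qed
  qed
  then have L: "Eext \<nu>S (\<lambda>s. ln_enn (\<integral>\<^sup>+ w. ennreal (D (s, w)) \<partial>\<kappa> s)) = ereal L"
    using Eext_integrable[OF int_d] by (simp add: L_def)

  \<comment> \<open>The divergence is nonnegative, so its extended expectation is just the integral
    of the positive part.\<close>
  have "(\<integral>\<^sup>+ s. e2ennreal (- Renyi \<alpha> (\<kappa> s) (q s)) \<partial>\<nu>S) = (\<integral>\<^sup>+ s. 0 \<partial>\<nu>S)"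
  proof (rule nn_integral_cong)
    fix s assume "s \<in> space \<nu>S"
    then have s: "s \<in> space M" by simp
    have "0 \<le> Renyi \<alpha> (\<kappa> s) (q s)"
      using prob_space_kappa[OF s] kernels_prob_space[OF q s] \<alpha> by (intro Renyi_nonneg) auto
    then show "e2ennreal (- Renyi \<alpha> (\<kappa> s) (q s)) = 0"
      by (intro e2ennreal_neg) (simp add: ereal_uminus_le_reorder)
  qed
  then have Ren: "Ren = enn2ereal (\<integral>\<^sup>+ s. e2ennreal (Renyi \<alpha> (\<kappa> s) (q s)) \<partial>\<nu>S)" (is "_ = enn2ereal ?RI")
    by (simp add: Ren_def Eext_def zero_ennreal.rep_eq)
  show ?thesis
  proof (cases "?RI = \<top> \<or> c = \<top>")
    case True
    then have inf: "Ren + ln_enn c = \<infinity>" by (auto simp: ln_enn_def Ren)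
    show ?thesis unfolding T inf by (simp add: L KL_K)
  next
    case False
    then obtain r where r: "0 \<le> r" "?RI = ennreal r" by (metis ennreal_cases)
    obtain c' where c': "0 \<le> c'" "c = ennreal c'"
      using False by (metis ennreal_cases)
    interpret Pq: prob_space "kjoint M N q" by (rule prob_space_kjoint[OF prob_space_axioms q])
    have "0 < c"
      unfolding c_def
      by (rule Pq.nn_integral_exp_pos)
         (simp add: measurable_cong_sets[OF sets_kjoint[OF not_empty] refl])
    with c' have c0: "0 < c'" by simp
    have ln_c: "ln_enn c = ereal (ln c')" using c0 by (simp add: c'(2) ln_enn_def)
    \<comment> \<open>A finite total moment makes the inner moment finite for almost every sample
      under \<open>M\<close>, hence under the absolutely continuous \<open>\<nu>S\<close>.\<close>
    have "AE s in M. cs s \<noteq> \<infinity>"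
      by (rule nn_integral_PInf_AE) (use False c_eq in auto)
    then have fin_M: "AE s in M. cs s = ennreal (enn2real (cs s)) \<and> 0 < enn2real (cs s)"
      using AE_space
    proof eventually_elim
      case (elim s)
      interpret qs: prob_space "q s" by (rule kernels_prob_space(1)[OF q elim(2)])
      have "0 < cs s"
        unfolding cs_def
        by (rule qs.nn_integral_exp_pos)
           (rule kernel_section_measurable[OF q elim(2), of "\<lambda>x. l * ln (f x)"], measurable)
      then show ?case using elim(1) by (simp add: enn2real_positive_iff less_top)
    qed
    define e where "e s = enn2real (cs s)" for s
    have e_m[measurable]: "e \<in> borel_measurable M" unfolding e_def by measurable
    define m where "m s = l * ln (d s) - ln (e s)" for s
    \<comment> \<open>The divergence need not be measurable in \<open>s\<close>; its measurable minorant \<open>m\<close> is all that is used.\<close>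
    have "AE s in \<nu>S. ennreal (m s) \<le> e2ennreal (Renyi \<alpha> (\<kappa> s) (q s))"
      using AE_nuS AE_space d_ae AE_nuS_imp[OF fin_M]
    proof eventually_elim
      case (elim s)
      then have s: "s \<in> space M" and bs: "0 < b s" using eta(1) by simp_all
      have "ereal (m s) \<le> Renyi \<alpha> (\<kappa> s) (q s)"
        unfolding m_def
      proof (rule Renyi_variational_bound[where L = "\<lambda>w. ln (f (s, w))" and D = "\<lambda>w. D (s, w)"])
        show "prob_space (\<kappa> s)" by (rule prob_space_kappa(1)[OF s])
        show "prob_space (q s)" by (rule kernels_prob_space(1)[OF q s])
        show "sets (\<kappa> s) = sets (q s)"
          by (simp add: kernels_prob_space(2)[OF q s] prob_space_kappa(2)[OF s])
        show "(\<lambda>w. ln (f (s, w))) \<in> borel_measurable (q s)"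
          by (rule kernel_section_measurable[OF q s, of "\<lambda>x. ln (f x)"]) measurable
        show "AE w in \<kappa> s. D (s, w) \<le> exp (ln (f (s, w)))"
          using AE_kappa[OF s bs]
        proof eventually_elim
          case (elim w)
          then have "(s, w) \<in> space (M \<Otimes>\<^sub>M N)" using sets.sets_into_space[OF A] by blast
          then show ?case using D_bound[OF elim] f_pos by simp
        qed
        show "0 < d s" using elim exp_gt_zero[of "- C"] by linarith
        show "(\<integral>\<^sup>+ w. ennreal (exp (l * ln (f (s, w)))) \<partial>q s) \<le> ennreal (e s)"
          using elim by (simp add: e_def cs_def)
      qed (use elim \<alpha> l in \<open>auto simp: e_def\<close>)
      then have "e2ennreal (ereal (m s)) \<le> e2ennreal (Renyi \<alpha> (\<kappa> s) (q s))" by (rule e2ennreal_mono)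
      then show ?case by simp
    qed
    then have m_le: "(\<integral>\<^sup>+ s. ennreal (m s) \<partial>\<nu>S) \<le> ennreal r"
      unfolding r(2)[symmetric] by (rule nn_integral_mono_AE)
    have "(\<integral>\<^sup>+ s. ennreal (exp (ln (e s))) \<partial>M) = (\<integral>\<^sup>+ s. cs s \<partial>M)"
      by (rule nn_integral_cong_AE, rule eventually_mono[OF fin_M]) (auto simp: e_def)
    then have exp_e: "(\<integral>\<^sup>+ s. ennreal (exp (ln (e s))) \<partial>M) \<le> ennreal c'"
      using c_eq c'(2) by simp
    \<comment> \<open>Donsker-Varadhan requires a finite negative part of \<open>ln (e s)\<close>.
      It comes from the Renyi bound: \<open>- ln (e s)\<close> equals
      \<open>m s - l * ln (d s)\<close>, where the positive part of \<open>m\<close> integrates to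
      at most \<open>r\<close>.\<close>
    have "(\<integral>\<^sup>+ s. ennreal (- ln (e s)) \<partial>\<nu>S) \<le> (\<integral>\<^sup>+ s. ennreal (m s) + ennreal (- (l * ln (d s))) \<partial>\<nu>S)"
    proof (rule nn_integral_mono)
      fix s
      show "ennreal (- ln (e s)) \<le> ennreal (m s) + ennreal (- (l * ln (d s)))"
        using ennreal_add_le[of "m s" "- (l * ln (d s))"] by (simp add: m_def)
    qed
    also have "\<dots> = (\<integral>\<^sup>+ s. ennreal (m s) \<partial>\<nu>S) + (\<integral>\<^sup>+ s. ennreal (- (l * ln (d s))) \<partial>\<nu>S)"
      unfolding m_def by (rule nn_integral_add) measurable
    also have "\<dots> < \<infinity>"
    proof -
      have "integrable \<nu>S (\<lambda>s. l * ln (d s))" using int_d by simp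
      then have "(\<integral>\<^sup>+ s. ennreal (- (l * ln (d s))) \<partial>\<nu>S) < \<infinity>"
        unfolding real_integrable_def by (simp add: less_top)
      moreover have "(\<integral>\<^sup>+ s. ennreal (m s) \<partial>\<nu>S) < \<infinity>"
        using m_le by (rule le_less_trans) simp
      ultimately show ?thesis by simp
    qed
    finally have neg: "(\<integral>\<^sup>+ s. ennreal (- ln (e s)) \<partial>\<nu>S) < \<infinity>" .
    have fin: "KL \<nu>S M < \<infinity>" by (simp add: KL_nuS)
    have ln_e_m: "(\<lambda>s. ln (e s)) \<in> borel_measurable M" by measurable
    note DV = Donsker_Varadhan[OF prob_space_axioms prob_space_nuS fin ln_e_m c0 exp_e neg]
    have upper: "(\<integral>s. ln (e s) \<partial>\<nu>S) \<le> B - ln a + ln c'"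
      using DV(2) by (simp add: KL_nuS B_def)
    have "integrable \<nu>S m"
      unfolding m_def[abs_def] using int_d DV(1) by simp
    then have "integral\<^sup>L \<nu>S m \<le> r"
      by (rule integral_le_nn_integral[OF _ r(1) m_le])
    moreover have "integral\<^sup>L \<nu>S m = l * L - (\<integral>s. ln (e s) \<partial>\<nu>S)"
      unfolding m_def[abs_def] L_def using int_d DV(1) by simp
    ultimately have "ln a \<le> r + ln c' + B - l * L"
      using upper by simp
    then show ?thesis
      using r(1) by (simp add: T L KL_K ln_c Ren r(2) enn2ereal_ennreal)
  qed
qed

end

section \<open>The generalization bound\<close>

theorem theorem3:
  fixes \<mu> :: "'z measure" and n :: nat
    and MW :: "'w measure" and K :: "(nat \<Rightarrow> 'z) \<Rightarrow> 'w measure"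
    and MH :: "'h measure"
    and f \<Delta> :: "(nat \<Rightarrow> 'z) \<times> 'w \<Rightarrow> real"
    and g :: "(nat \<Rightarrow> 'z) \<times> 'h \<Rightarrow> real"
    and \<delta> :: real
  defines "PS \<equiv> PiM {..<n} (\<lambda>_. \<mu>)"
  defines "PSW \<equiv> kjoint PS MW K"
  defines "F \<equiv> Gset \<delta> PSW \<inter> Sset PSW (\<lambda>x. f x - \<Delta> x)"
  assumes mu: "prob_space \<mu>"
    and K: "K \<in> kernels PS MW"
    and f_meas: "f \<in> borel_measurable (PS \<Otimes>\<^sub>M MW)"
    and D_meas: "\<Delta> \<in> borel_measurable (PS \<Otimes>\<^sub>M MW)"
    and D_pos: "\<And>x. x \<in> space (PS \<Otimes>\<^sub>M MW) \<Longrightarrow> \<Delta> x > 0"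
    and g_meas: "g \<in> borel_measurable (PS \<Otimes>\<^sub>M MH)"
    and \<delta>: "\<delta> > 0"
    and cond:
      "(\<exists>\<epsilon>::real. \<forall>\<nu>\<in>F.
          (INF p \<in> {p \<in> kernels PS MH.
                   Eext (kjoint3 \<nu> MH p) (\<lambda>x. ereal (\<Delta> (fst x) - g (fst (fst x), snd x))) \<le> ereal \<epsilon>}.
             (INF lq \<in> {lq. fst lq > 0 \<and> snd lq \<in> kernels PS MH}.
                Tfun 1 PS (distr \<nu> PS fst) MH p (snd lq) (\<lambda>x. fst lq * g x)
                - KL \<nu> (kjoint (distr \<nu> PS fst) MW K)
                - ereal (fst lq) * (Eext \<nu> (\<lambda>x. ereal (\<Delta> x)) - ereal \<epsilon>)))
          \<le> ereal (ln \<delta>))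
       \<or>
       ((\<forall>x\<in>space (PS \<Otimes>\<^sub>M MW). f x > 0) \<and>
        (\<exists>\<alpha>::real. \<alpha> > 1 \<and> (\<forall>\<nu>\<in>F. \<forall>\<kappa>\<in>kernels PS MW.
           \<nu> = kjoint (distr \<nu> PS fst) MW \<kappa> \<longrightarrow>
           (INF lq \<in> {lq. fst lq \<ge> \<alpha> / (\<alpha> - 1) \<and> snd lq \<in> kernels PS MW}.
              Tfun \<alpha> PS (distr \<nu> PS fst) MW \<kappa> (snd lq) (\<lambda>x. fst lq * ln (f x))
              - KL \<nu> (kjoint (distr \<nu> PS fst) MW K)
              - ereal (fst lq) *
                  Eext (distr \<nu> PS fst) (\<lambda>s. ln_enn (\<integral>\<^sup>+ w. ennreal (\<Delta> (s, w)) \<partial>(\<kappa> s))))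
           \<le> ereal (ln \<delta>))))"
  shows "measure PSW {x \<in> space PSW. f x \<le> \<Delta> x} \<ge> 1 - \<delta>"
proof (rule ccontr)
  assume contra: "\<not> 1 - \<delta> \<le> measure PSW {x \<in> space PSW. f x \<le> \<Delta> x}"
  have PS: "prob_space PS"
    unfolding PS_def by (intro prob_space_PiM mu)
  interpret PS: prob_space PS by (rule PS)
  interpret PSW: prob_space PSW
    unfolding PSW_def by (rule prob_space_kjoint[OF PS K])
  have sets_PSW[measurable_cong]: "sets PSW = sets (PS \<Otimes>\<^sub>M MW)"
    unfolding PSW_def by (rule sets_kjoint) (rule PS.not_empty)
  note f_meas[measurable] D_meas[measurable]
  define B where "B = {x \<in> space PSW. \<Delta> x < f x}"
  have B[measurable]: "B \<in> sets PSW" unfolding B_def by measurable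
  have "B = space PSW - {x \<in> space PSW. f x \<le> \<Delta> x}"
    by (auto simp: B_def)
  then have "measure PSW B = 1 - measure PSW {x \<in> space PSW. f x \<le> \<Delta> x}"
    by (simp add: PSW.prob_compl)
  with contra have "\<delta> < measure PSW B" by simp
  \<comment> \<open>Truncating \<open>ln (\<Delta> x)\<close> confines \<open>\<Delta>\<close> to
    the interval from \<open>exp (- C)\<close> to \<open>exp C\<close>: case (i) uses the upper
    bound, case (ii) both.\<close>
  then obtain C where C: "\<delta> < measure PSW {x \<in> B. \<bar>ln (\<Delta> x)\<bar> \<le> C}"
      "{x \<in> B. \<bar>ln (\<Delta> x)\<bar> \<le> C} \<in> sets PSW"
    by (rule PSW.prob_gt_bounded_part[rotated 2, where h = "\<lambda>x. ln (\<Delta> x)"]) measurable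
  \<comment> \<open>This reduction comes last because \<open>\<eta>\<close> bounds the sections of
    the final \<open>A\<close>, and further shrinking could destroy the bound.\<close>
  obtain A \<eta> where reg: "A \<in> sets (PS \<Otimes>\<^sub>M MW)" "A \<subseteq> {x \<in> B. \<bar>ln (\<Delta> x)\<bar> \<le> C}"
      "\<delta> < measure PSW A" and sect: "0 < \<eta>" "\<forall>(s, w)\<in>A. \<eta> \<le> measure (K s) (Pair s -` A)"
    using C(1) unfolding PSW_def
    by (rule exists_uniform_sections_subset[OF PS K C(2)[unfolded sets_PSW]])
  interpret conditioned_kernel PS MW K A \<eta>
    using K reg(1,3) sect \<delta> unfolding PSW_def by unfold_locales auto
  have P_eq: "P = PSW" by (simp add: P_def PSW_def)
  have less: "ln \<delta> < ln a"
    using reg(3) \<delta> by (simp add: a_def P_eq)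
  have on_A: "exp (- C) \<le> \<Delta> x \<and> \<Delta> x \<le> exp C \<and> \<Delta> x \<le> f x \<and> 0 < \<Delta> x" if "x \<in> A" for x
  proof -
    have x: "x \<in> B" "\<bar>ln (\<Delta> x)\<bar> \<le> C" using that reg(2) by auto
    have "0 < \<Delta> x" using that sets.sets_into_space[OF reg(1)] D_pos by blast
    moreover have "exp (- C) \<le> exp (ln (\<Delta> x))" "exp (ln (\<Delta> x)) \<le> exp C" using x(2) by auto
    ultimately show ?thesis using x(1) by (simp add: B_def)
  qed
  \<comment> \<open>The divergence from \<open>PSW\<close> is \<open>- ln a\<close>, below
    \<open>ln (1 / \<delta>)\<close> since \<open>a\<close> exceeds \<open>\<delta>\<close>; the
    positivity condition holds because \<open>A\<close> lies in the failure event.\<close>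
  have nu_F: "\<nu> \<in> F"
  proof -
    have "AE x in \<nu>. 0 < f x - \<Delta> x"
      using AE_nu by eventually_elim (use reg(2) in \<open>auto simp: B_def\<close>)
    moreover have "KL \<nu> PSW \<le> ereal (ln (1 / \<delta>))"
      using KL_nu_P less \<delta> a_pos by (simp add: P_eq ln_div)
    ultimately show ?thesis
      using prob_space_nu by (simp add: F_def Gset_def Sset_def sets_nu sets_PSW)
  qed
  have nuS: "distr \<nu> PS fst = \<nu>S" by (simp add: \<nu>S_def)
  have less': "ereal (ln \<delta>) < ereal (ln a)" using less by simp
  from cond show False
  proof (elim disjE exE conjE)
    fix \<epsilon> :: real
    assume "\<forall>\<nu>\<in>F.
          (INF p \<in> {p \<in> kernels PS MH.
                   Eext (kjoint3 \<nu> MH p) (\<lambda>x. ereal (\<Delta> (fst x) - g (fst (fst x), snd x))) \<le> ereal \<epsilon>}.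
             (INF lq \<in> {lq. fst lq > 0 \<and> snd lq \<in> kernels PS MH}.
                Tfun 1 PS (distr \<nu> PS fst) MH p (snd lq) (\<lambda>x. fst lq * g x)
                - KL \<nu> (kjoint (distr \<nu> PS fst) MW K)
                - ereal (fst lq) * (Eext \<nu> (\<lambda>x. ereal (\<Delta> x)) - ereal \<epsilon>)))
          \<le> ereal (ln \<delta>)"
    \<comment> \<open>The infima need not be attained. The strict gap between
      \<open>ln \<delta>\<close> and \<open>ln a\<close> still provides concrete \<open>p\<close>,
      \<open>l\<close> and \<open>q\<close> with value below \<open>ln a\<close>.\<close>
    from le_less_trans[OF bspec[OF this nu_F] less']
    obtain p l q where "p \<in> kernels PS MH" "0 < l" "q \<in> kernels PS MH"
      "Eext (kjoint3 \<nu> MH p) (\<lambda>x. ereal (\<Delta> (fst x) - g (fst (fst x), snd x))) \<le> ereal \<epsilon>"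
      and lt: "Tfun 1 PS \<nu>S MH p q (\<lambda>x. l * g x) - KL \<nu> (kjoint \<nu>S MW K)
        - ereal l * (Eext \<nu> (\<lambda>x. ereal (\<Delta> x)) - ereal \<epsilon>) < ereal (ln a)"
      unfolding INF_less_iff nuS by auto
    then have "ereal (ln a) \<le> Tfun 1 PS \<nu>S MH p q (\<lambda>x. l * g x) - KL \<nu> (kjoint \<nu>S MW K)
        - ereal l * (Eext \<nu> (\<lambda>x. ereal (\<Delta> x)) - ereal \<epsilon>)"
      using on_A by (intro Tfun_1_bound[where C = "exp C"] D_meas g_meas) (auto intro: less_imp_le)
    with lt show False by simp
  next
    fix \<alpha> :: real
    assume f_pos: "\<forall>x\<in>space (PS \<Otimes>\<^sub>M MW). f x > 0" and \<alpha>: "\<alpha> > 1"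
      and "\<forall>\<nu>\<in>F. \<forall>\<kappa>\<in>kernels PS MW.
           \<nu> = kjoint (distr \<nu> PS fst) MW \<kappa> \<longrightarrow>
           (INF lq \<in> {lq. fst lq \<ge> \<alpha> / (\<alpha> - 1) \<and> snd lq \<in> kernels PS MW}.
              Tfun \<alpha> PS (distr \<nu> PS fst) MW \<kappa> (snd lq) (\<lambda>x. fst lq * ln (f x))
              - KL \<nu> (kjoint (distr \<nu> PS fst) MW K)
              - ereal (fst lq) *
                  Eext (distr \<nu> PS fst) (\<lambda>s. ln_enn (\<integral>\<^sup>+ w. ennreal (\<Delta> (s, w)) \<partial>(\<kappa> s))))
           \<le> ereal (ln \<delta>)"
    \<comment> \<open>The hypothesis is instantiated at \<open>\<kappa>\<close>, a conditional of
      \<open>\<nu>\<close> by \<open>nu_eq_kjoint_kappa\<close>, and the same strict gap yields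
      \<open>l\<close> and \<open>q\<close>.\<close>
    from le_less_trans[OF mp[OF bspec[OF bspec[OF this(3) nu_F] kappa_kernel], unfolded nuS, OF nu_eq_kjoint_kappa] less']
    obtain l q where "\<alpha> / (\<alpha> - 1) \<le> l" "q \<in> kernels PS MW"
      and lt: "Tfun \<alpha> PS \<nu>S MW \<kappa> q (\<lambda>x. l * ln (f x)) - KL \<nu> (kjoint \<nu>S MW K)
        - ereal l * Eext \<nu>S (\<lambda>s. ln_enn (\<integral>\<^sup>+ w. ennreal (\<Delta> (s, w)) \<partial>\<kappa> s)) < ereal (ln a)"
      unfolding INF_less_iff by auto
    then have "ereal (ln a) \<le> Tfun \<alpha> PS \<nu>S MW \<kappa> q (\<lambda>x. l * ln (f x)) - KL \<nu> (kjoint \<nu>S MW K)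
        - ereal l * Eext \<nu>S (\<lambda>s. ln_enn (\<integral>\<^sup>+ w. ennreal (\<Delta> (s, w)) \<partial>\<kappa> s))"
      using on_A f_pos \<alpha> by (intro Tfun_Renyi_bound[where C = C] f_meas D_meas) auto
    with lt show False by simp
  qed
qed

end
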